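(* Let $n\ge 2$, let $f\in L^1(\mathbb{R}^n)$, and let $u$ be the harmonic (Poisson) extension of $f$ to the upper half space $\mathbb{R}^{n+1}_+=\{(x,y): x\in\mathbb{R}^n,\ y>0\}$. For $\theta\in S_{n-1}$ and $z\in\mathbb{C}$ with $\Im z>0$ set $$F_\theta(z)=\int_0^\infty e^{2i\pi r z}\,\hat f(r\theta)\,r^{n-1}\,dr .$$ Then for all $x\in\mathbb{R}^n$ and $y>0$, $$u(x,y)=\int_{S_{n-1}}F_\theta(x\cdot\theta+iy)\,d\theta ,$$ and for every $\theta\in S_{n-1}$ and every $z$ with $\Im z>0$, $$F_\theta(z)=\frac{(n-1)!}{(2i\pi)^n}\int_{-\infty}^{+\infty}\frac{\mathsf{R}_\theta f(t)}{(t-z)^n}\,dt .$$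
   Context: The Fourier transform is $\hat f(\xi)=\int_{\mathbb{R}^n}f(x)e^{-2i\pi x\cdot\xi}\,dx$. $S_{n-1}$ is the unit sphere of $\mathbb{R}^n$ and $d\theta$ its (unnormalized) surface measure. The harmonic extension is $u(x,y)=(f\star \mathsf{P}_y)(x)$, where $\mathsf{P}_y$ is the Poisson kernel on $\mathbb{R}^n$, i.e. $\widehat{\mathsf{P}_y}(\xi)=e^{-2\pi|\xi|y}$. The Radon transform in direction $\theta\in S_{n-1}$ is $\mathsf{R}_\theta f(t)=\int_{x\in\theta^\perp}f(t\theta+x)\,dx$, where $\theta^\perp$ is the hyperplane through $0$ orthogonal to $\theta$ with its $(n-1)$-dimensional Lebesgue measure (for $f\in L^1$ it is defined for almost every $t\in\mathbb{R}$). *)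

theory Defs
  imports "HOL-Analysis.Analysis"
begin

definition fourier_transform :: "('a::euclidean_space \<Rightarrow> complex) \<Rightarrow> 'a \<Rightarrow> complex" where
  "fourier_transform f \<xi> = (LINT x|lebesgue. f x * exp (- 2 * \<i> * pi * (x \<bullet> \<xi>)))"

(* With n = DIM('a), the constant is the one for which the kernel has total mass 1 and, for the
   Fourier transform above, transform exp (- 2 * pi * norm \<xi> * y). *)
definition poisson_kernel :: "real \<Rightarrow> 'a::euclidean_space \<Rightarrow> real" where
  "poisson_kernel y x =
     Gamma ((real DIM('a) + 1) / 2) / pi powr ((real DIM('a) + 1) / 2) *
     (y / ((norm x)\<^sup>2 + y\<^sup>2) powr ((real DIM('a) + 1) / 2))"

definition poisson_extension :: "('a::euclidean_space \<Rightarrow> complex) \<Rightarrow> 'a \<Rightarrow> real \<Rightarrow> complex" where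
  "poisson_extension f x y = (LINT t|lebesgue. f (x - t) * poisson_kernel y t)"

(* Unnormalized surface measure, as a measure on the unit sphere, via polar coordinates: the measure
   of A is DIM('a) times the volume of the cone {r *\<^sub>R \<theta> | r \<theta>. 0 < r \<and> r \<le> 1 \<and> \<theta> \<in> A}. *)
definition sphere_measure :: "'a::euclidean_space measure" where
  "sphere_measure =
     scale_measure (of_nat DIM('a))
       (distr (restrict_space lborel (cball 0 1 - {0})) (restrict_space borel (sphere 0 1)) sgn)"

lemma space_sphere_measure: "space (sphere_measure :: 'a::euclidean_space measure) = sphere 0 1"
  by (simp add: sphere_measure_def space_scale_measure space_restrict_space)

lemma sets_sphere_measure:
  "sets (sphere_measure :: 'a::euclidean_space measure) = sets (restrict_space borel (sphere 0 1))"
  by (simp add: sphere_measure_def)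

lemma emeasure_sphere_measure:
  fixes A :: "'a::euclidean_space set"
  assumes "A \<in> sets borel" "A \<subseteq> sphere 0 1"
  shows "emeasure sphere_measure A =
    of_nat DIM('a) * emeasure lborel {r *\<^sub>R \<theta> | r \<theta>. 0 < r \<and> r \<le> 1 \<and> \<theta> \<in> A}"
proof -
  let ?M = "restrict_space lborel (cball 0 1 - {0}) :: 'a measure"
  have sgn_b: "(sgn :: 'a \<Rightarrow> 'a) \<in> borel_measurable borel"
    unfolding sgn_div_norm [abs_def] by measurable
  have meas: "(sgn :: 'a \<Rightarrow> 'a) \<in> measurable ?M (restrict_space borel (sphere 0 1))"
    by (rule measurable_restrict_space3)
       (use sgn_b in \<open>auto simp: norm_sgn\<close>)
  have A: "A \<in> sets (restrict_space borel (sphere 0 1))"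
    using assms by (auto simp: sets_restrict_space_iff)
  have eq: "sgn -` A \<inter> space ?M = {r *\<^sub>R \<theta> | r \<theta>. 0 < r \<and> r \<le> 1 \<and> \<theta> \<in> A}" (is "?L = ?R")
  proof (intro equalityI subsetI)
    fix x assume "x \<in> ?L"
    then have "x = norm x *\<^sub>R sgn x" "0 < norm x" "norm x \<le> 1" "sgn x \<in> A"
      by (auto simp: space_restrict_space sgn_div_norm)
    then show "x \<in> ?R" by blast
  next
    fix x assume "x \<in> ?R"
    then obtain r \<theta> where r: "x = r *\<^sub>R \<theta>" "0 < r" "r \<le> 1" "\<theta> \<in> A" by blast
    moreover have "norm \<theta> = 1" using r assms by auto
    ultimately show "x \<in> ?L"
      by (auto simp: space_restrict_space sgn_div_norm)
  qed
  have "emeasure sphere_measure A = of_nat DIM('a) * emeasure ?M (sgn -` A \<inter> space ?M)"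
    by (simp add: sphere_measure_def emeasure_distr [OF meas A])
  also have "emeasure ?M (sgn -` A \<inter> space ?M) = emeasure lborel (sgn -` A \<inter> space ?M)"
    by (rule emeasure_restrict_space) (auto simp: space_restrict_space)
  finally show ?thesis by (simp only: eq)
qed

definition orthonormal_basis_of :: "'a::euclidean_space set \<Rightarrow> 'a set \<Rightarrow> bool" where
  "orthonormal_basis_of S B \<longleftrightarrow>
     pairwise orthogonal B \<and> (\<forall>b\<in>B. norm b = 1) \<and> span B = S"

(* Lebesgue measure on the subspace S, carried by S inside the ambient space; as for lborel, it is
   transported from product Lebesgue measure on coordinates. The choice of B is immaterial. *)
definition subspace_lebesgue :: "'a::euclidean_space set \<Rightarrow> 'a measure" where
  "subspace_lebesgue S =
     (let B = (SOME B. orthonormal_basis_of S B)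
      in completion (distr (\<Pi>\<^sub>M b\<in>B. lborel) borel (\<lambda>c. \<Sum>b\<in>B. c b *\<^sub>R b)))"

lemma orthonormal_basis_of_exists:
  assumes "subspace S"
  shows "\<exists>B. orthonormal_basis_of S B"
  using orthonormal_basis_subspace [OF assms] by (metis orthonormal_basis_of_def)

definition radon_transform ::
    "'a::euclidean_space \<Rightarrow> ('a \<Rightarrow> complex) \<Rightarrow> real \<Rightarrow> complex" where
  "radon_transform \<theta> f t = (LINT x|subspace_lebesgue {x. \<theta> \<bullet> x = 0}. f (t *\<^sub>R \<theta> + x))"

definition directional_F ::
    "('a::euclidean_space \<Rightarrow> complex) \<Rightarrow> 'a \<Rightarrow> complex \<Rightarrow> complex" where
  "directional_F f \<theta> z =
     (LINT r:{0<..}|lborel.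
        exp (2 * \<i> * pi * r * z) * fourier_transform f (r *\<^sub>R \<theta>) * of_real (r ^ (DIM('a) - 1)))"

end

theory Submission
  imports Defs "HOL-Probability.Probability"
begin

text \<open>Inserting the definition of the Fourier transform into \<open>F\<^sub>\<theta>(z)\<close> and integrating in \<open>r\<close> first gives
  \<open>F\<^sub>\<theta>(z) = \<integral> f(x) k(x \<bullet> \<theta> - z) dx\<close> with \<open>k(s) = (n-1)! / (2\<pi>i s)\<^sup>n\<close>. Slicing the space along the
  hyperplanes orthogonal to \<open>\<theta>\<close> turns this into the integral of the Radon transform against \<open>k(t - z)\<close>.
  Integrating instead over \<open>\<theta>\<close> leaves the convolution of \<open>f\<close> with a kernel which, by polar
  coordinates, is the inverse Fourier transform of \<open>exp (-2\<pi> norm \<xi> y)\<close>; writing this exponential as a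
  superposition of Gaussians identifies it with the Poisson kernel.\<close>

section \<open>Completions of measures\<close>

text \<open>The definitions integrate over completed measures and \<open>f\<close> is only Lebesgue
  measurable, whereas Fubini and changes of variables live on Borel product and image measures. So
  \<open>f\<close> is exchanged once for a Borel function \<open>f'\<close> that agrees with it
  almost everywhere. The delicate place is the Radon transform: a hyperplane is itself a null set,
  and \<open>f = f'\<close> survives only on almost every hyperplane. No Fourier inversion for
  \<open>f\<close> is needed, although its transform need not be integrable. The factor
  \<open>exp (2 * \<i> * pi * r * z)\<close> has modulus \<open>exp (- 2 * pi * r * Im z)\<close>,
  so every exchange of integrals involving \<open>f'\<close> converges absolutely, and the only
  inverse transform to be computed is an explicit one. The two geometric measures must be tied to
  Lebesgue measure by uniqueness arguments: the hyperplane measure, built from an arbitrary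
  orthonormal basis, by translation invariance and one Gaussian integral that fixes the constant;
  the spherical measure, defined by volumes of cones, by the scaling of cones.\<close>

text \<open>Preimages under \<open>f\<close> and \<open>f'\<close> differ inside a null set, all of
  whose subsets are measurable in the completion. Nothing is assumed about \<open>f\<close> itself,
  because this is applied to slices of \<open>f\<close> and to the Radon transform, which are known
  only up to null sets.\<close>

lemma completion_AE_measurable:
  fixes f f' :: "'a \<Rightarrow> 'b::topological_space"
  assumes [measurable]: "f' \<in> borel_measurable M" and ae: "AE x in M. f x = f' x"
  shows "f \<in> borel_measurable (completion M)"
proof (rule measurableI)
  fix A :: "'b set" assume [measurable]: "A \<in> sets borel"
  obtain N where N: "{x\<in>space M. \<not> f x = f' x} \<subseteq> N" "N \<in> null_sets M"
    using AE_E[OF ae] by (metis null_setsI)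
  have "f -` A \<inter> space M = (f' -` A \<inter> space M - N) \<union> (f -` A \<inter> space M \<inter> N)"
    using N(1) by auto
  moreover have "f' -` A \<inter> space M - N \<in> sets (completion M)"
    using N(2) by (intro sets_completionI_sets) auto
  moreover have "f -` A \<inter> space M \<inter> N \<in> sets (completion M)"
    using null_sets_completion[OF N(2), of "f -` A \<inter> space M \<inter> N"] by auto
  ultimately show "f -` A \<inter> space (completion M) \<in> sets (completion M)"
    by (metis sets.Un space_completion)
qed auto

text \<open>The bridge by which the completed integrals of the definitions become integrals of Borel
  functions.\<close>

lemma integral_completion_cong_AE:
  fixes f f' :: "'a \<Rightarrow> 'b::{banach, second_countable_topology}"
  assumes "f' \<in> borel_measurable M" "AE x in M. f x = f' x"
  shows "integral\<^sup>L (completion M) f = integral\<^sup>L M f'"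
proof -
  have "integral\<^sup>L (completion M) f = integral\<^sup>L (completion M) f'"
    using assms by (intro integral_cong_AE completion_AE_measurable[OF assms] measurable_completion AE_completion)
  then show ?thesis using integral_completion[OF assms(1)] by simp
qed

lemma integrable_completion_imp_borel:
  fixes f :: "'a \<Rightarrow> complex"
  assumes f: "integrable (completion M) f"
  obtains f' where "integrable M f'" "AE x in M. f x = f' x"
proof -
  have "(\<lambda>x. Re (f x)) \<in> borel_measurable (completion M)"
    "(\<lambda>x. Im (f x)) \<in> borel_measurable (completion M)"
    using borel_measurable_integrable[OF f] by measurable
  from this[THEN completion_ex_borel_measurable_real]
  obtain u v where [measurable]: "u \<in> borel_measurable M" "v \<in> borel_measurable M"
    and ae: "AE x in M. Re (f x) = u x" "AE x in M. Im (f x) = v x" by auto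
  define f' where "f' x = Complex (u x) (v x)" for x
  have f'm [measurable]: "f' \<in> borel_measurable M"
    unfolding f'_def[abs_def] Complex_eq by measurable
  have ae': "AE x in M. f x = f' x"
    using ae by eventually_elim (simp add: f'_def complex_eq_iff)
  have "integrable (completion M) f'"
    using f ae' by (subst integrable_cong_AE[of _ _ f]) (auto intro: measurable_completion AE_completion)
  then have "integrable M f'" by (simp add: integrable_completion)
  then show ?thesis using ae' that by blast
qed

section \<open>Laplace transform of powers\<close>

text \<open>Integration by parts, as a recursion in \<open>k\<close> for the antiderivative. Only
  its limit at infinity and its value at 0 are recorded, since the fundamental theorem asks for no
  more. As \<open>s\<close> is complex, the real Gamma integral would not suffice.\<close>

lemma power_exp_antiderivative:
  fixes s :: complex assumes s: "Re s > 0"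
  shows "\<exists>F. (\<forall>r::real. (F has_vector_derivative exp (- (s * r)) * of_real r ^ k) (at r)) \<and>
    (F \<longlongrightarrow> 0) at_top \<and> F 0 = - fact k / s ^ Suc k"
proof -
  have s0: "s \<noteq> 0" using s by auto
  have lim: "((\<lambda>r::real. exp (- (s * r)) * of_real r ^ k) \<longlongrightarrow> 0) at_top" for k :: nat
  proof (rule tendsto_norm_zero_cancel)
    have "((\<lambda>r::real. exp (- (Re s * r)) * r ^ k) \<longlongrightarrow> 0) at_top"
      using s by real_asymp
    then show "((\<lambda>r::real. norm (exp (- (s * r)) * of_real r ^ k)) \<longlongrightarrow> 0) at_top"
    proof (rule Lim_transform_eventually)
      show "\<forall>\<^sub>F r::real in at_top. exp (- (Re s * r)) * r ^ k = norm (exp (- (s * r)) * of_real r ^ k)"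
        using eventually_ge_at_top[of 0]
        by eventually_elim (simp add: norm_mult norm_power)
    qed
  qed
  show ?thesis
  proof (induction k)
    case 0
    show ?case
    proof (intro exI[of _ "\<lambda>r. - exp (- (s * of_real r)) / s"] conjI allI)
      show "((\<lambda>r. - exp (- (s * of_real r)) / s) has_vector_derivative exp (- (s * r)) * of_real r ^ 0) (at r)" for r
        using s0 by (auto intro!: derivative_eq_intros has_vector_derivative_real_field)
      show "((\<lambda>r. - exp (- (s * of_real r)) / s) \<longlongrightarrow> 0) at_top"
        using tendsto_divide[OF tendsto_minus[OF lim[of 0]] tendsto_const[of s]] s0 by simp
    qed (use s0 in simp)
  next
    case (Suc k)
    then obtain F where F: "\<And>r::real. (F has_vector_derivative exp (- (s * r)) * of_real r ^ k) (at r)"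
      "(F \<longlongrightarrow> 0) at_top" "F 0 = - fact k / s ^ Suc k" by blast
    let ?G = "\<lambda>r::real. - exp (- (s * r)) * of_real r ^ Suc k / s + of_nat (Suc k) / s * F r"
    show ?case
    proof (intro exI[of _ ?G] conjI allI)
      fix r :: real
      have "((\<lambda>z. - exp (- (s * z)) * z ^ Suc k / s) has_field_derivative
         exp (- (s * r)) * of_real r ^ Suc k - of_nat (Suc k) / s * (exp (- (s * r)) * of_real r ^ k)) (at (of_real r))"
        by (rule DERIV_cong[OF DERIV_cdivide[OF DERIV_mult[OF DERIV_minus[OF
            DERIV_fun_exp[OF DERIV_minus[OF DERIV_cmult[OF DERIV_ident]]]] DERIV_power[OF DERIV_ident]]]])
          (use s0 in \<open>simp add: field_simps\<close>)
      from has_vector_derivative_real_field[OF this]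
      have "((\<lambda>r. - exp (- (s * of_real r)) * of_real r ^ Suc k / s) has_vector_derivative
         exp (- (s * r)) * of_real r ^ Suc k - of_nat (Suc k) / s * (exp (- (s * r)) * of_real r ^ k)) (at r)" .
      from has_vector_derivative_add[OF this has_vector_derivative_mult_right[OF F(1)[of r], of "of_nat (Suc k) / s"]]
      show "(?G has_vector_derivative exp (- (s * r)) * of_real r ^ Suc k) (at r)"
        by simp
    next
      show "(?G \<longlongrightarrow> 0) at_top"
        using tendsto_add[OF tendsto_divide[OF tendsto_minus[OF lim[of "Suc k"]] tendsto_const[of s]]
            tendsto_mult[OF tendsto_const[of "of_nat (Suc k) / s"] F(2)]] s0 by simp
      show "?G 0 = - fact (Suc k) / s ^ Suc (Suc k)"
        using s0 by (simp add: F(3) field_simps)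
    qed
  qed
qed

text \<open>The modulus of the integrand is the same function with \<open>Re s\<close> in place of
  \<open>s\<close>. That one is nonnegative and has an antiderivative with finite limits, so it is
  integrable and serves as the dominating function.\<close>

lemma set_integrable_exp_power:
  fixes s :: complex assumes s: "Re s > 0"
  shows "set_integrable lborel {0<..} (\<lambda>r::real. exp (- (s * r)) * of_real r ^ k)"
proof -
  obtain F where F: "\<And>r::real. (F has_vector_derivative exp (- (complex_of_real (Re s) * r)) * of_real r ^ k) (at r)"
    "(F \<longlongrightarrow> 0) at_top"
    using power_exp_antiderivative[of "complex_of_real (Re s)" k] s by auto
  let ?h = "\<lambda>r. exp (- (Re s * r)) * r ^ k"
  have D: "DERIV (\<lambda>r. Re (F r)) r :> ?h r" for r
  proof -
    have "exp (- (complex_of_real (Re s) * r)) * of_real r ^ k = complex_of_real (?h r)"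
      by (simp add: of_real_exp)
    with bounded_linear.has_vector_derivative[OF bounded_linear_Re F(1)[of r]]
    have "((\<lambda>r. Re (F r)) has_vector_derivative ?h r) (at r)"
      by (simp only: Re_complex_of_real)
    then show ?thesis by (simp add: has_real_derivative_iff_has_vector_derivative)
  qed
  have cont: "isCont F 0" using F(1)[of 0] has_vector_derivative_continuous by blast
  have "set_integrable lborel (einterval 0 \<infinity>) ?h"
  proof (rule interval_integral_FTC_nonneg(1)[where F = "\<lambda>r. Re (F r)" and A = "Re (F 0)" and B = 0])
    show "((((\<lambda>r. Re (F r)) \<circ> real_of_ereal)) \<longlongrightarrow> Re (F 0)) (at_right 0)"
      unfolding zero_ereal_def ereal_tendsto_simps
      using cont by (intro tendsto_Re) (simp add: isCont_def filterlim_at_split)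
    show "((((\<lambda>r. Re (F r)) \<circ> real_of_ereal)) \<longlongrightarrow> 0) (at_left \<infinity>)"
      unfolding ereal_tendsto_simps using tendsto_Re[OF F(2)] by simp
  qed (use D in \<open>auto intro!: continuous_intros\<close>)
  then have "integrable lborel (\<lambda>r. indicator {0<..} r *\<^sub>R ?h r)"
    by (simp add: set_integrable_def einterval_def zero_ereal_def greaterThan_def)
  then show ?thesis
    unfolding set_integrable_def
  proof (rule Bochner_Integration.integrable_bound)
    show "AE r in lborel. norm (indicator {0<..} r *\<^sub>R (exp (- (s * complex_of_real r)) * complex_of_real r ^ k))
            \<le> norm (indicator {0<..} r *\<^sub>R (exp (- (Re s * r)) * r ^ k))"
      by (intro AE_I2) (auto simp: norm_mult norm_power indicator_def)
  qed measurable
qed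

lemma set_integral_exp_power:
  fixes s :: complex assumes s: "Re s > 0"
  shows "(LINT r:{0<..}|lborel. exp (- (s * of_real r)) * of_real r ^ k) = fact k / s ^ Suc k"
proof -
  obtain F where F: "\<And>r::real. (F has_vector_derivative exp (- (s * r)) * of_real r ^ k) (at r)"
    "(F \<longlongrightarrow> 0) at_top" "F 0 = - fact k / s ^ Suc k"
    using power_exp_antiderivative[OF s, of k] by auto
  have E: "einterval 0 \<infinity> = {0<..}" by (auto simp: einterval_def)
  have cont: "isCont F 0" using F(1)[of 0] has_vector_derivative_continuous by blast
  have "(LBINT r=0..\<infinity>. exp (- (s * of_real r)) * of_real r ^ k) = 0 - F 0"
  proof (rule interval_integral_FTC_integrable)
    show "set_integrable lborel (einterval 0 \<infinity>) (\<lambda>r. exp (- (s * of_real r)) * of_real r ^ k)"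
      using set_integrable_exp_power[OF s, of k] unfolding E .
    show "((F \<circ> real_of_ereal) \<longlongrightarrow> F 0) (at_right 0)"
      unfolding zero_ereal_def ereal_tendsto_simps
      using cont by (simp add: isCont_def filterlim_at_split)
    show "((F \<circ> real_of_ereal) \<longlongrightarrow> 0) (at_left \<infinity>)"
      unfolding ereal_tendsto_simps using F(2) .
  qed (use F(1) in \<open>auto intro!: continuous_intros\<close>)
  then show ?thesis
    by (simp add: interval_lebesgue_integral_def E F(3))
qed

section \<open>Lebesgue measure in orthonormal coordinates\<close>

lemma orthonormal_basis_of_independent:
  assumes "orthonormal_basis_of S B"
  shows "finite B" "independent B"
proof -
  have "0 \<notin> B" "pairwise orthogonal B"
    using assms by (auto simp: orthonormal_basis_of_def)
  then show "independent B"
    by (intro pairwise_orthogonal_independent)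
  then show "finite B"
    using independent_bound by blast
qed

lemma norm_sum_orthonormal:
  assumes "orthonormal_basis_of S B"
  shows "(norm (\<Sum>b\<in>B. c b *\<^sub>R b))\<^sup>2 = (\<Sum>b\<in>B. (c b)\<^sup>2)"
proof -
  have "(norm (\<Sum>b\<in>B. c b *\<^sub>R b))\<^sup>2 = (\<Sum>b\<in>B. (norm (c b *\<^sub>R b))\<^sup>2)"
    using assms by (intro norm_sum_Pythagorean orthonormal_basis_of_independent(1)[OF assms])
      (auto simp: orthonormal_basis_of_def pairwise_def orthogonal_def)
  also have "\<dots> = (\<Sum>b\<in>B. (c b)\<^sup>2)"
    using assms by (intro sum.cong) (auto simp: orthonormal_basis_of_def)
  finally show ?thesis .
qed

section \<open>Uniqueness of translation invariant measure, normalized by a Gaussian\<close>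

lemma nn_integral_lborel_translate:
  fixes f :: "'a::euclidean_space \<Rightarrow> ennreal"
  assumes [measurable]: "f \<in> borel_measurable borel"
  shows "(\<integral>\<^sup>+x. f (a + x) \<partial>lborel) = (\<integral>\<^sup>+x. f x \<partial>lborel)"
  by (subst (2) lborel_distr_plus[symmetric, of a]) (simp add: nn_integral_distr)

lemma lborel_distr_reflect:
  fixes a :: "'a::euclidean_space"
  shows "distr lborel borel (\<lambda>x. a - x) = lborel"
  by (subst (2) lborel_affine[of "-1" a]) (auto simp: density_1 one_ennreal_def[symmetric])

lemma nn_integral_lborel_reflect:
  fixes f :: "'a::euclidean_space \<Rightarrow> ennreal"
  assumes [measurable]: "f \<in> borel_measurable borel"
  shows "(\<integral>\<^sup>+x. f (a - x) \<partial>lborel) = (\<integral>\<^sup>+x. f x \<partial>lborel)"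
  by (subst (2) lborel_distr_reflect[symmetric, of a]) (simp add: nn_integral_distr)

lemma emeasure_distr_conv_nn_integral:
  assumes "L \<in> measurable P N" "A \<in> sets N"
  shows "emeasure (distr P N L) A = (\<integral>\<^sup>+p. indicator A (L p) \<partial>P)"
  using assms by (subst nn_integral_distr[symmetric]) auto

text \<open>Uniqueness of Haar measure: both sides are compared through
  \<open>\<integral>\<integral> f(L p) G(L p + y) dy dP(p)\<close>.\<close>
lemma translation_invariant_distr_eq_lborel:
  fixes L :: "'b \<Rightarrow> 'a::euclidean_space"
  assumes "sigma_finite_measure P" and L [measurable]: "L \<in> borel_measurable P"
    and inv: "\<And>a. distr P borel (\<lambda>p. a + L p) = distr P borel L"
    and [measurable]: "G \<in> borel_measurable borel"
    and G: "(\<integral>\<^sup>+p. G (L p) \<partial>P) = c" "(\<integral>\<^sup>+x. G x \<partial>lborel) = c" "c \<noteq> 0" "c \<noteq> top"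
  shows "distr P borel L = lborel"
proof (rule measure_eqI)
  interpret P: sigma_finite_measure P by fact
  interpret PL: pair_sigma_finite P "lborel :: 'a measure" ..
  fix A assume "A \<in> sets (distr P borel L)"
  then have A [measurable]: "A \<in> sets borel" by simp
  let ?f = "indicator A :: 'a \<Rightarrow> ennreal"
  \<comment> \<open>Translation invariance moves the shift from \<open>G\<close> to the indicator.
    Once both orders of integration are available, the \<open>y\<close>-integral sees
    \<open>G\<close> alone on one side and the indicator alone on the other.\<close>
  have *: "(\<integral>\<^sup>+p. ?f (L p) * G (L p + y) \<partial>P) = (\<integral>\<^sup>+p. ?f (L p - y) * G (L p) \<partial>P)" for y
  proof -
    have "(\<integral>\<^sup>+p. ?f (L p - y) * G (L p) \<partial>P) = (\<integral>\<^sup>+x. ?f (x - y) * G x \<partial>distr P borel L)"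
      by (subst nn_integral_distr) auto
    also have "\<dots> = (\<integral>\<^sup>+x. ?f (x - y) * G x \<partial>distr P borel (\<lambda>p. y + L p))"
      by (simp only: inv)
    also have "\<dots> = (\<integral>\<^sup>+p. ?f (L p) * G (L p + y) \<partial>P)"
      by (subst nn_integral_distr) (auto simp: add.commute)
    finally show ?thesis ..
  qed
  have "emeasure (distr P borel L) A * c = (\<integral>\<^sup>+p. ?f (L p) * c \<partial>P)"
    by (subst nn_integral_multc) (auto simp: emeasure_distr_conv_nn_integral)
  also have "\<dots> = (\<integral>\<^sup>+p. (\<integral>\<^sup>+y. ?f (L p) * G (L p + y) \<partial>lborel) \<partial>P)"
    using G(2) by (simp add: nn_integral_cmult nn_integral_lborel_translate)
  also have "\<dots> = (\<integral>\<^sup>+y. (\<integral>\<^sup>+p. ?f (L p) * G (L p + y) \<partial>P) \<partial>lborel)"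
    by (rule PL.Fubini'[symmetric]) measurable
  also have "\<dots> = (\<integral>\<^sup>+y. (\<integral>\<^sup>+p. ?f (L p - y) * G (L p) \<partial>P) \<partial>lborel)"
    by (simp only: *)
  also have "\<dots> = (\<integral>\<^sup>+p. (\<integral>\<^sup>+y. ?f (L p - y) * G (L p) \<partial>lborel) \<partial>P)"
    by (rule PL.Fubini') measurable
  also have "\<dots> = (\<integral>\<^sup>+p. emeasure lborel A * G (L p) \<partial>P)"
    by (subst nn_integral_multc) (auto simp: nn_integral_lborel_reflect)
  also have "\<dots> = emeasure lborel A * c"
    by (simp add: nn_integral_cmult G(1))
  finally show "emeasure (distr P borel L) A = emeasure lborel A"
    using G(3,4) by (metis ennreal_mult_cancel_left mult.commute)
qed simp

interpretation lborel_PiM: product_sigma_finite "\<lambda>_. lborel :: real measure" ..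

text \<open>A product measure is determined by its values on boxes, and there the claim is
  translation invariance in each coordinate. The restricted abstraction keeps the image inside the
  space of extensional functions.\<close>

lemma distr_PiM_lborel_translate:
  assumes "finite I"
  shows "distr (Pi\<^sub>M I (\<lambda>_. lborel)) (Pi\<^sub>M I (\<lambda>_. lborel)) (\<lambda>c. \<lambda>i\<in>I. \<alpha> i + c i) =
    Pi\<^sub>M I (\<lambda>_. lborel :: real measure)" (is "distr ?P ?P ?T = ?P")
proof (rule lborel_PiM.PiM_eqI[OF assms])
  fix A :: "_ \<Rightarrow> real set" assume A: "\<And>i. i \<in> I \<Longrightarrow> A i \<in> sets lborel"
  have T: "?T \<in> measurable ?P ?P" by measurable
  have A': "(+) (\<alpha> i) -` A i \<in> sets lborel" if "i \<in> I" for i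
    using measurable_sets[of "(+) (\<alpha> i)" borel borel "A i"] A[OF that] by simp
  have "emeasure (distr ?P ?P ?T) (Pi\<^sub>E I A) = emeasure ?P (?T -` Pi\<^sub>E I A \<inter> space ?P)"
    using A by (intro emeasure_distr[OF T] sets_PiM_I_finite assms)
  also have "?T -` Pi\<^sub>E I A \<inter> space ?P = Pi\<^sub>E I (\<lambda>i. (+) (\<alpha> i) -` A i)"
    by (auto simp: space_PiM PiE_def Pi_def)
  also have "emeasure ?P \<dots> = (\<Prod>i\<in>I. emeasure lborel ((+) (\<alpha> i) -` A i))"
    using A' by (intro lborel_PiM.emeasure_PiM assms)
  also have "\<dots> = (\<Prod>i\<in>I. emeasure lborel (A i))"
  proof (rule prod.cong[OF refl])
    fix i assume "i \<in> I"
    then show "emeasure lborel ((+) (\<alpha> i) -` A i) = emeasure lborel (A i)"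
      using A[of i] by (subst (2) lborel_distr_plus[symmetric, of "\<alpha> i"]) (simp add: emeasure_distr)
  qed
  finally show "emeasure (distr ?P ?P ?T) (Pi\<^sub>E I A) = (\<Prod>i\<in>I. emeasure lborel (A i))" .
qed simp

lemma nn_integral_gaussian:
  "(\<integral>\<^sup>+x. ennreal (exp (- (x::real)\<^sup>2)) \<partial>lborel) = ennreal (sqrt pi)"
proof -
  \<comment> \<open>Standard deviation \<open>1 / sqrt 2\<close> makes the exponent exactly
    \<open>- x\<^sup>2\<close>; total mass 1 then gives the value.\<close>
  have N: "normal_density 0 (1 / sqrt 2) = (\<lambda>x. exp (- x\<^sup>2) / sqrt pi)"
    by (auto simp: normal_density_def power_divide)
  have "integrable lborel (normal_density 0 (1 / sqrt 2))"
    "(\<integral>x. normal_density 0 (1 / sqrt 2) x \<partial>lborel) = 1"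
    by auto
  note * = this[unfolded N]
  have "integrable lborel (\<lambda>x::real. exp (- x\<^sup>2))"
    using integrable_mult_left[OF *(1), of "sqrt pi"] by simp
  moreover have "(\<integral>x. exp (- (x::real)\<^sup>2) \<partial>lborel) = sqrt pi"
    using *(2) by (simp add: field_simps)
  ultimately show ?thesis by (subst nn_integral_eq_integral) auto
qed

text \<open>By Pythagoras the Gaussian splits into one factor per coordinate, so its integral is the
  same for every orthonormal basis. This common value, finite and nonzero, excludes a constant
  factor between the measures.\<close>

lemma nn_integral_gaussian_orthonormal:
  assumes "orthonormal_basis_of UNIV (B :: 'a::euclidean_space set)"
  shows "(\<integral>\<^sup>+c. ennreal (exp (- (norm (\<Sum>b\<in>B. c b *\<^sub>R b))\<^sup>2)) \<partial>Pi\<^sub>M B (\<lambda>_. lborel)) =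
    ennreal (sqrt pi ^ DIM('a))"
proof -
  note B = orthonormal_basis_of_independent[OF assms]
  have "card B = DIM('a)"
    using B assms dim_eq_card[of B "UNIV :: 'a set"] by (simp add: orthonormal_basis_of_def)
  have "(\<integral>\<^sup>+c. ennreal (exp (- (norm (\<Sum>b\<in>B. c b *\<^sub>R b))\<^sup>2)) \<partial>Pi\<^sub>M B (\<lambda>_. lborel)) =
      (\<integral>\<^sup>+c. (\<Prod>b\<in>B. ennreal (exp (- (c b)\<^sup>2))) \<partial>Pi\<^sub>M B (\<lambda>_. lborel))"
    by (simp add: norm_sum_orthonormal[OF assms] exp_sum B prod_ennreal flip: sum_negf)
  also have "\<dots> = (\<Prod>b\<in>B. \<integral>\<^sup>+x. ennreal (exp (- x\<^sup>2)) \<partial>lborel)"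
    by (intro lborel_PiM.product_nn_integral_prod B) auto
  also have "\<dots> = ennreal (sqrt pi ^ DIM('a))"
    by (simp add: nn_integral_gaussian \<open>card B = _\<close> ennreal_power)
  finally show ?thesis .
qed

lemma orthonormal_basis_of_Basis: "orthonormal_basis_of UNIV (Basis :: 'a::euclidean_space set)"
  by (auto simp: orthonormal_basis_of_def pairwise_def orthogonal_def inner_Basis)

text \<open>Since \<open>B\<close> spans the space, every translation is a shift of coordinates,
  which makes the image measure translation invariant; the Gaussian settles the normalization.
  Rotation invariance of Lebesgue measure is thereby obtained without determinants.\<close>

lemma distr_orthonormal_eq_lborel:
  assumes "orthonormal_basis_of UNIV (B :: 'a::euclidean_space set)"
  shows "distr (Pi\<^sub>M B (\<lambda>_. lborel)) borel (\<lambda>c. \<Sum>b\<in>B. c b *\<^sub>R b) = lborel"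
proof (rule translation_invariant_distr_eq_lborel[where G = "\<lambda>x. ennreal (exp (- (norm x)\<^sup>2))"])
  note B = orthonormal_basis_of_independent[OF assms]
  let ?P = "Pi\<^sub>M B (\<lambda>_. lborel :: real measure)"
  show "sigma_finite_measure ?P"
    by (intro lborel_PiM.sigma_finite B)
  show L [measurable]: "(\<lambda>c. \<Sum>b\<in>B. c b *\<^sub>R b) \<in> borel_measurable ?P"
    by measurable
  show "distr ?P borel (\<lambda>c. a + (\<Sum>b\<in>B. c b *\<^sub>R b)) = distr ?P borel (\<lambda>c. \<Sum>b\<in>B. c b *\<^sub>R b)" for a
  proof -
    have "a \<in> span B" using assms by (simp add: orthonormal_basis_of_def)
    then obtain \<alpha> where \<alpha>: "a = (\<Sum>b\<in>B. \<alpha> b *\<^sub>R b)"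
      using span_finite[OF B(1)] by auto
    have "distr ?P borel (\<lambda>c. \<Sum>b\<in>B. c b *\<^sub>R b) =
        distr (distr ?P ?P (\<lambda>c. \<lambda>i\<in>B. \<alpha> i + c i)) borel (\<lambda>c. \<Sum>b\<in>B. c b *\<^sub>R b)"
      by (simp only: distr_PiM_lborel_translate[OF B(1)])
    also have "\<dots> = distr ?P borel (\<lambda>c. a + (\<Sum>b\<in>B. c b *\<^sub>R b))"
      by (subst distr_distr[OF L])
        (auto simp: o_def \<alpha> sum.distrib[symmetric] scaleR_add_left intro!: distr_cong sum.cong)
    finally show ?thesis ..
  qed
  show "(\<integral>\<^sup>+c. ennreal (exp (- (norm (\<Sum>b\<in>B. c b *\<^sub>R b))\<^sup>2)) \<partial>?P) = ennreal (sqrt pi ^ DIM('a))"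
    by (rule nn_integral_gaussian_orthonormal[OF assms])
  show "(\<integral>\<^sup>+x. ennreal (exp (- (norm (x::'a))\<^sup>2)) \<partial>lborel) = ennreal (sqrt pi ^ DIM('a))"
    by (subst lborel_eq, subst nn_integral_distr)
      (use nn_integral_gaussian_orthonormal[OF orthonormal_basis_of_Basis] in auto)
qed auto

section \<open>Decomposition of Lebesgue measure along parallel hyperplanes\<close>

lemma orthonormal_basis_of_insert_hyperplane:
  assumes "norm \<theta> = 1" "orthonormal_basis_of {x. \<theta> \<bullet> x = 0} B"
  shows "orthonormal_basis_of UNIV (insert \<theta> B)" "\<theta> \<notin> B"
proof -
  have perp: "\<theta> \<bullet> b = 0" if "b \<in> span B" for b
    using assms(2) that by (auto simp: orthonormal_basis_of_def)
  then show "\<theta> \<notin> B" using assms(1) span_base[of \<theta> B] by (auto simp: norm_eq_1)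
  have "x \<in> span (insert \<theta> B)" for x
  proof -
    have "x - (\<theta> \<bullet> x) *\<^sub>R \<theta> \<in> span B"
      using assms by (auto simp: orthonormal_basis_of_def inner_diff_right norm_eq_1)
    then show ?thesis
      unfolding span_insert by blast
  qed
  with assms perp show "orthonormal_basis_of UNIV (insert \<theta> B)"
    by (auto simp: orthonormal_basis_of_def pairwise_insert orthogonal_def span_base inner_commute)
qed

lemma lborel_eq_distr_hyperplane:
  fixes \<theta> :: "'a::euclidean_space"
  assumes "norm \<theta> = 1" "orthonormal_basis_of {x. \<theta> \<bullet> x = 0} B"
  shows "lborel = distr (lborel \<Otimes>\<^sub>M Pi\<^sub>M B (\<lambda>_. lborel)) borel (\<lambda>(t, c). t *\<^sub>R \<theta> + (\<Sum>b\<in>B. c b *\<^sub>R b))"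
    (is "_ = distr (lborel \<Otimes>\<^sub>M ?P) borel ?S")
proof (rule measure_eqI)
  note B' = orthonormal_basis_of_insert_hyperplane[OF assms]
  have fin: "finite B" by (rule orthonormal_basis_of_independent[OF assms(2)])
  interpret P: sigma_finite_measure ?P by (intro lborel_PiM.sigma_finite fin)
  have [measurable]: "?S \<in> borel_measurable (lborel \<Otimes>\<^sub>M ?P)" by measurable
  fix A :: "'a set" assume "A \<in> sets lborel"
  then have [measurable]: "A \<in> sets borel" by simp
  have "emeasure lborel A = (\<integral>\<^sup>+c. indicator A (\<Sum>b\<in>insert \<theta> B. c b *\<^sub>R b) \<partial>Pi\<^sub>M (insert \<theta> B) (\<lambda>_. lborel))"
    by (subst distr_orthonormal_eq_lborel[OF B'(1), symmetric])
      (subst nn_integral_indicator[symmetric], simp, subst nn_integral_distr, auto)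
  \<comment> \<open>The coordinate along \<open>\<theta>\<close> is split off and placed outermost;
    it becomes the variable of the Radon transform.\<close>
  also have "\<dots> = (\<integral>\<^sup>+t. \<integral>\<^sup>+c. indicator A (\<Sum>b\<in>insert \<theta> B. (c(\<theta> := t)) b *\<^sub>R b) \<partial>?P \<partial>lborel)"
    by (rule lborel_PiM.product_nn_integral_insert_rev) (use fin B'(2) in auto)
  also have "\<dots> = (\<integral>\<^sup>+t. \<integral>\<^sup>+c. indicator A (?S (t, c)) \<partial>?P \<partial>lborel)"
  proof -
    have "(\<Sum>b\<in>insert \<theta> B. (c(\<theta> := t)) b *\<^sub>R b) = ?S (t, c)" for c :: "'a \<Rightarrow> real" and t
      using fin B'(2) by (auto intro!: sum.cong)
    then show ?thesis by (simp only:)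
  qed
  also have "\<dots> = (\<integral>\<^sup>+p. indicator A (?S p) \<partial>(lborel \<Otimes>\<^sub>M ?P))"
    by (rule P.nn_integral_fst) measurable
  also have "\<dots> = emeasure (distr (lborel \<Otimes>\<^sub>M ?P) borel ?S) A"
    by (rule emeasure_distr_conv_nn_integral[symmetric]) auto
  finally show "emeasure lborel A = \<dots>" .
qed simp

section \<open>Polar coordinates\<close>

lemma measurable_sphere_measure_ident:
  "(\<lambda>\<theta>. \<theta>) \<in> borel_measurable (sphere_measure :: 'a::euclidean_space measure)"
  by (subst measurable_cong_sets[OF sets_sphere_measure refl]) (intro measurable_restrict_space1 measurable_ident_sets refl)

lemma measurable_sgn_sphere_measure:
  "sgn \<in> measurable (restrict_space lborel (- {0})) (sphere_measure :: 'a::euclidean_space measure)"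
proof -
  have "sgn \<in> measurable (restrict_space lborel (- {0})) (restrict_space borel (sphere (0::'a) 1))"
    by (rule measurable_restrict_space3) (simp_all add: norm_sgn)
  then show ?thesis
    by (simp add: sets_sphere_measure cong: measurable_cong_sets)
qed

lemma finite_measure_sphere_measure: "finite_measure (sphere_measure :: 'a::euclidean_space measure)"
proof
  have "emeasure (sphere_measure :: 'a measure) (sphere 0 1) =
    of_nat DIM('a) * emeasure lborel {r *\<^sub>R \<theta> | r \<theta>. 0 < r \<and> r \<le> 1 \<and> \<theta> \<in> sphere (0::'a) 1}"
    by (rule emeasure_sphere_measure) auto
  moreover have "bounded {r *\<^sub>R \<theta> | r \<theta>. 0 < r \<and> r \<le> 1 \<and> \<theta> \<in> sphere (0::'a) 1}"
    by (rule bounded_subset[OF bounded_cball[of 0 1]]) auto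
  ultimately show "emeasure (sphere_measure :: 'a measure) (space sphere_measure) \<noteq> \<infinity>"
    using emeasure_bounded_finite by (auto simp: space_sphere_measure ennreal_mult_eq_top_iff top_unique less_top[symmetric])
qed

section \<open>Lebesgue measure as the product of a radial and a spherical part\<close>

lemma emeasure_lborel_scale:
  fixes S :: "'a::euclidean_space set"
  assumes "a > 0" and [measurable]: "S \<in> sets borel"
  shows "emeasure lborel S = ennreal (a ^ DIM('a)) * emeasure lborel {x. a *\<^sub>R x \<in> S}"
proof -
  have "emeasure lborel S = emeasure (density (distr lborel borel (\<lambda>x. 0 + a *\<^sub>R x)) (\<lambda>_. \<bar>a\<bar> ^ DIM('a))) S"
    using assms by (subst lborel_affine[of a 0]) auto
  also have "\<dots> = ennreal (a ^ DIM('a)) * emeasure lborel ((\<lambda>x. a *\<^sub>R x) -` S)"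
    using assms by (simp add: emeasure_density nn_integral_cmult emeasure_distr)
  also have "(\<lambda>x. a *\<^sub>R x) -` S = {x. a *\<^sub>R x \<in> S}" by auto
  finally show ?thesis .
qed

text \<open>The radial factor of polar coordinates. It is kept on the whole line, with density zero
  off the open half-line, so that its sigma-algebra is that of \<open>borel\<close>.\<close>

definition radial_measure :: "nat \<Rightarrow> real measure" where
  "radial_measure n = density lborel (\<lambda>r. ennreal (indicator {0<..} r * r ^ (n - 1)))"

lemma sets_radial_measure [simp, measurable_cong]: "sets (radial_measure n) = sets borel"
  by (simp add: radial_measure_def)

lemma space_radial_measure [simp]: "space (radial_measure n) = UNIV"
  by (simp add: radial_measure_def)

lemma emeasure_radial_measure_atMost:
  assumes "n > 0"
  shows "emeasure (radial_measure n) {..a} = ennreal (if a \<le> 0 then 0 else a ^ n / n)"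
proof -
  have "emeasure (radial_measure n) {..a} = (\<integral>\<^sup>+r. ennreal (r ^ (n - 1)) * indicator {0..a} r \<partial>lborel)"
    unfolding radial_measure_def
  proof (subst emeasure_density, simp, simp, rule nn_integral_cong_AE)
    show "AE r in lborel. ennreal (indicator {0<..} r * r ^ (n - 1)) * indicator {..a} r =
        ennreal (r ^ (n - 1)) * indicator {0..a} r"
      using AE_lborel_singleton[of "0::real"] by eventually_elim (auto simp: indicator_def)
  qed
  also have "\<dots> = ennreal (if a \<le> 0 then 0 else a ^ n / n)"
  proof (cases "a \<le> 0")
    case True
    have "(\<integral>\<^sup>+r. ennreal (r ^ (n - 1)) * indicator {0..a} r \<partial>lborel) = (\<integral>\<^sup>+r. 0 \<partial>(lborel :: real measure))"
      by (rule nn_integral_cong_AE, use AE_lborel_singleton[of "0::real"] in eventually_elim)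
        (use True in \<open>auto simp: indicator_def\<close>)
    with True show ?thesis by simp
  next
    case False
    have "(\<integral>\<^sup>+r. ennreal (r ^ (n - 1)) * indicator {0..a} r \<partial>lborel) = ennreal (a ^ n / n - 0 ^ n / n)"
    proof (rule nn_integral_FTC_Icc)
      show "((\<lambda>r. r ^ n / n) has_real_derivative r ^ (n - 1)) (at r)" for r
        using assms by (auto intro!: derivative_eq_intros)
    qed (use False in auto)
    with False assms show ?thesis by (simp add: power_0_left)
  qed
  finally show ?thesis .
qed

lemma sigma_finite_radial_measure:
  assumes "n > 0"
  shows "sigma_finite_measure (radial_measure n)"
proof
  show "\<exists>A. countable A \<and> A \<subseteq> sets (radial_measure n) \<and> \<Union> A = space (radial_measure n) \<and>
      (\<forall>a\<in>A. emeasure (radial_measure n) a \<noteq> \<infinity>)"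
    by (rule exI[of _ "range (\<lambda>i::nat. {..real i})"])
      (auto simp: emeasure_radial_measure_atMost[OF assms] real_arch_simple)
qed

text \<open>It suffices to compare rectangles \<open>A \<times> B\<close>. With \<open>B\<close>
  fixed, both sides are measures in \<open>A\<close>, and for \<open>A = {..a}\<close> with
  \<open>a > 0\<close> the claim is that the cone over \<open>B\<close> cut at radius
  \<open>a\<close> has \<open>a ^ n\<close> times the volume of the cone cut at radius 1, where
  \<open>n\<close> is the dimension.\<close>

lemma polar_product_measure:
  "radial_measure DIM('a) \<Otimes>\<^sub>M sphere_measure =
    distr (restrict_space lborel (- {0})) (radial_measure DIM('a) \<Otimes>\<^sub>M sphere_measure)
      (\<lambda>x::'a::euclidean_space. (norm x, sgn x))"
    (is "?R \<Otimes>\<^sub>M _ = distr ?L _ ?p")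
proof (rule pair_measure_eqI)
  show "sigma_finite_measure ?R"
    by (rule sigma_finite_radial_measure) simp
  show "sigma_finite_measure (sphere_measure :: 'a measure)"
    by (intro finite_measure.axioms(1) finite_measure_sphere_measure)
  have sgn [measurable]: "sgn \<in> measurable ?L (sphere_measure :: 'a measure)"
    by (rule measurable_sgn_sphere_measure)
  have nrm [measurable]: "norm \<in> borel_measurable ?L"
    by (intro measurable_restrict_space1) measurable
  have p [measurable]: "?p \<in> measurable ?L (?R \<Otimes>\<^sub>M sphere_measure)"
    by measurable
  fix A :: "real set" and B :: "'a set"
  assume A: "A \<in> sets ?R" and B: "B \<in> sets sphere_measure"
  then have Bb [measurable]: "B \<in> sets borel" and Bs: "B \<subseteq> sphere 0 1"
    by (auto simp: sets_sphere_measure sets_restrict_space)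
  \<comment> \<open>\<open>C\<close> is the full open cone over \<open>B\<close>, and
    \<open>K\<close> below is its part in the unit ball, which is the set measured by
    \<open>sphere_measure\<close>.\<close>
  define C where "C = {x. x \<noteq> 0 \<and> sgn x \<in> B}"
  have Cb [measurable]: "C \<in> sets borel" unfolding C_def by measurable
  define K where "K = {r *\<^sub>R \<theta> | r \<theta>. 0 < r \<and> r \<le> 1 \<and> \<theta> \<in> B}"
  have KC: "K = C \<inter> norm -` {..1}"
  proof (intro equalityI subsetI)
    fix x assume "x \<in> K"
    then obtain r \<theta> where "x = r *\<^sub>R \<theta>" "0 < r" "r \<le> 1" "\<theta> \<in> B" by (auto simp: K_def)
    moreover have "norm \<theta> = 1" using \<open>\<theta> \<in> B\<close> Bs by auto
    ultimately show "x \<in> C \<inter> norm -` {..1}" by (auto simp: C_def sgn_div_norm)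
  next
    fix x assume "x \<in> C \<inter> norm -` {..1}"
    then have "x = norm x *\<^sub>R sgn x" "0 < norm x" "norm x \<le> 1" "sgn x \<in> B"
      by (auto simp: C_def sgn_div_norm)
    then show "x \<in> K" unfolding K_def by blast
  qed
  have \<sigma>B: "emeasure sphere_measure B = of_nat DIM('a) * emeasure lborel K"
    unfolding K_def by (rule emeasure_sphere_measure[OF Bb Bs])
  \<comment> \<open>The half-lines \<open>{..a}\<close> are stable under intersection and generate
    the Borel sets; finiteness of the spherical measure provides the exhausting sequence.\<close>
  have "scale_measure (emeasure sphere_measure B) ?R = distr (restrict_space lborel C) borel norm"
  proof (rule measure_eqI_generator_eq)
    let ?E = "range (\<lambda>a::real. {..a})"
    show "Int_stable ?E" by (auto simp: Int_stable_def)
    show "sets (scale_measure (emeasure sphere_measure B) ?R) = sigma_sets UNIV ?E"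
      "sets (distr (restrict_space lborel C) borel norm) = sigma_sets UNIV ?E"
      by (simp_all add: borel_eq_atMost)
    show "range (\<lambda>i::nat. {..real i}) \<subseteq> ?E" "(\<Union>i::nat. {..real i}) = UNIV"
      by (auto simp: real_arch_simple)
    show "emeasure (scale_measure (emeasure sphere_measure B) ?R) {..real i} \<noteq> \<infinity>" for i
      using finite_measure.emeasure_finite[OF finite_measure_sphere_measure, of B]
      by (auto simp: emeasure_radial_measure_atMost ennreal_mult_eq_top_iff)
    fix X assume "X \<in> ?E"
    then obtain a where X: "X = {..a}" by auto
    have "emeasure (distr (restrict_space lborel C) borel norm) {..a} = emeasure lborel (C \<inter> norm -` {..a})"
      by (subst emeasure_distr)
        (auto intro!: measurable_restrict_space1 simp: emeasure_restrict_space space_restrict_space Int_commute)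
    also have "\<dots> = emeasure sphere_measure B * emeasure ?R {..a}"
    proof (cases "a \<le> 0")
      case True
      then have "C \<inter> norm -` {..a} = {}" by (auto simp: C_def dest: order_trans)
      with True show ?thesis by (simp add: emeasure_radial_measure_atMost)
    next
      case False
      then have "emeasure lborel (C \<inter> norm -` {..a}) =
          ennreal (a ^ DIM('a)) * emeasure lborel {x. a *\<^sub>R x \<in> C \<inter> norm -` {..a}}"
        by (intro emeasure_lborel_scale) auto
      also have "{x. a *\<^sub>R x \<in> C \<inter> norm -` {..a}} = K"
        using False by (auto simp: KC C_def sgn_scaleR)
      \<comment> \<open>The dimension factor in \<open>sphere_measure\<close> cancels the
        denominator of the radial mass \<open>a ^ n / n\<close>.\<close>
      also have "ennreal (a ^ DIM('a)) * emeasure lborel K =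
          emeasure lborel K * (of_nat DIM('a) * ennreal (a ^ DIM('a) / DIM('a)))"
        using False by (simp add: ennreal_of_nat_eq_real_of_nat ennreal_mult[symmetric] mult.commute)
      finally show ?thesis
        using False by (simp add: \<sigma>B emeasure_radial_measure_atMost mult_ac)
    qed
    finally show "emeasure (scale_measure (emeasure sphere_measure B) ?R) X =
        emeasure (distr (restrict_space lborel C) borel norm) X"
      by (simp add: X)
  qed auto
  then have "emeasure sphere_measure B * emeasure ?R A = emeasure (distr (restrict_space lborel C) borel norm) A"
    by (metis emeasure_scale_measure)
  also have "\<dots> = emeasure lborel (C \<inter> norm -` A)"
    using A by (subst emeasure_distr)
      (auto intro!: measurable_restrict_space1 simp: emeasure_restrict_space space_restrict_space Int_commute)
  also have "\<dots> = emeasure (distr ?L (?R \<Otimes>\<^sub>M sphere_measure) ?p) (A \<times> B)"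
  proof (subst emeasure_distr)
    show "A \<times> B \<in> sets (?R \<Otimes>\<^sub>M sphere_measure)" using A B by auto
    have "?p -` (A \<times> B) \<inter> space ?L = C \<inter> norm -` A"
      by (auto simp: C_def space_restrict_space)
    moreover have "emeasure ?L (C \<inter> norm -` A) = emeasure lborel (C \<inter> norm -` A)"
      by (rule emeasure_restrict_space) (auto simp: C_def)
    ultimately show "emeasure lborel (C \<inter> norm -` A) = emeasure ?L (?p -` (A \<times> B) \<inter> space ?L)"
      by (simp only:)
  qed simp
  finally show "emeasure ?R A * emeasure sphere_measure B =
      emeasure (distr ?L (?R \<Otimes>\<^sub>M sphere_measure) ?p) (A \<times> B)"
    by (simp add: mult.commute)
qed simp

lemma measurable_polar [measurable]:
  "(\<lambda>(r, \<theta>). r *\<^sub>R \<theta>) \<in> borel_measurable (radial_measure n \<Otimes>\<^sub>M (sphere_measure :: 'a::euclidean_space measure))"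
proof -
  have [measurable]: "snd \<in> borel_measurable (radial_measure n \<Otimes>\<^sub>M (sphere_measure :: 'a measure))"
    by (rule measurable_compose[OF measurable_snd measurable_sphere_measure_ident])
  have [measurable]: "fst \<in> borel_measurable (radial_measure n \<Otimes>\<^sub>M (sphere_measure :: 'a measure))"
    by (rule measurable_compose[OF measurable_fst]) simp
  show ?thesis unfolding case_prod_unfold by measurable
qed

lemma lborel_eq_distr_polar:
  "lborel = distr (radial_measure DIM('a) \<Otimes>\<^sub>M sphere_measure) borel (\<lambda>(r, \<theta>). r *\<^sub>R \<theta> :: 'a::euclidean_space)"
proof (rule measure_eqI)
  fix A :: "'a set" assume "A \<in> sets lborel"
  then have [measurable]: "A \<in> sets borel" by simp
  let ?L = "restrict_space lborel (- {0}) :: 'a measure"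
  have sgn [measurable]: "sgn \<in> measurable ?L (sphere_measure :: 'a measure)"
    by (rule measurable_sgn_sphere_measure)
  have nrm [measurable]: "norm \<in> borel_measurable ?L"
    by (intro measurable_restrict_space1) measurable
  have "emeasure (distr (radial_measure DIM('a) \<Otimes>\<^sub>M sphere_measure) borel (\<lambda>(r, \<theta>). r *\<^sub>R \<theta> :: 'a)) A =
      emeasure (distr ?L borel (\<lambda>x. norm x *\<^sub>R sgn x)) A"
    by (subst polar_product_measure, subst distr_distr) (auto simp: o_def)
  also have "\<dots> = emeasure (distr ?L borel (\<lambda>x. x)) A"
  proof -
    have "norm x *\<^sub>R sgn x = x" for x :: 'a
      by (cases "x = 0") (auto simp: sgn_div_norm)
    then show ?thesis by simp
  qed
  also have "\<dots> = emeasure lborel (A - {0})"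
    by (subst emeasure_distr) (auto intro!: measurable_restrict_space1 simp: emeasure_restrict_space space_restrict_space Diff_eq)
  also have "\<dots> = emeasure lborel A"
    by (rule emeasure_Diff_null_set) auto
  finally show "emeasure lborel A =
      emeasure (distr (radial_measure DIM('a) \<Otimes>\<^sub>M sphere_measure) borel (\<lambda>(r, \<theta>). r *\<^sub>R \<theta> :: 'a)) A" ..
qed simp

lemma integral_polar:
  fixes h :: "'a::euclidean_space \<Rightarrow> 'b::{banach, second_countable_topology}"
  assumes h: "integrable lborel h"
  shows "(LINT x|lborel. h x) =
    (LINT \<theta>|sphere_measure. (LINT r:{0<..}|lborel. r ^ (DIM('a) - 1) *\<^sub>R h (r *\<^sub>R \<theta>)))"
proof -
  let ?R = "radial_measure DIM('a)"
  interpret pair_sigma_finite ?R "sphere_measure :: 'a measure"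
    by (intro pair_sigma_finite.intro sigma_finite_radial_measure finite_measure.axioms(1)
        finite_measure_sphere_measure) simp
  have [measurable]: "h \<in> borel_measurable borel" using h by auto
  have int: "integrable (?R \<Otimes>\<^sub>M sphere_measure) (\<lambda>(r, \<theta>). h (r *\<^sub>R \<theta>))"
    using h by (subst (asm) lborel_eq_distr_polar) (subst (asm) integrable_distr_eq, auto simp: case_prod_unfold)
  have "(LINT x|lborel. h x) = (LINT p|(?R \<Otimes>\<^sub>M sphere_measure). (case p of (r, \<theta>) \<Rightarrow> h (r *\<^sub>R \<theta>)))"
    by (subst lborel_eq_distr_polar, subst integral_distr) (auto simp: case_prod_unfold)
  also have "\<dots> = (LINT \<theta>|sphere_measure. LINT r|?R. h (r *\<^sub>R \<theta>))"
    by (rule integral_snd[OF int, symmetric])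
  also have "\<dots> = (LINT \<theta>|sphere_measure. (LINT r:{0<..}|lborel. r ^ (DIM('a) - 1) *\<^sub>R h (r *\<^sub>R \<theta>)))"
  proof -
    have "(LINT r|?R. h (r *\<^sub>R \<theta>)) =
        (LINT r|lborel. (indicator {0<..} r * r ^ (DIM('a) - 1)) *\<^sub>R h (r *\<^sub>R \<theta>))" for \<theta>
      unfolding radial_measure_def by (rule integral_density) (auto simp: indicator_def)
    then show ?thesis by (simp add: set_lebesgue_integral_def)
  qed
  finally show ?thesis .
qed

section \<open>Subordination\<close>

text \<open>The error function up to normalization, started at minus infinity so that its limits are
  0 and \<open>sqrt pi\<close>. The antiderivative in the subordination formula is built from
  it.\<close>

definition erf_int :: "real \<Rightarrow> real" where
  "erf_int s = (LINT t:{..s}|lborel. exp (- t\<^sup>2))"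

lemma integrable_gaussian: "integrable lborel (\<lambda>x::real. exp (- x\<^sup>2))"
  using nn_integral_gaussian by (intro integrableI_nonneg) auto

lemma integral_gaussian: "(LINT x|lborel. exp (- (x::real)\<^sup>2)) = sqrt pi"
  using nn_integral_gaussian by (subst integral_eq_nn_integral) auto

lemma erf_int_at_top: "(erf_int \<longlongrightarrow> sqrt pi) at_top"
  using tendsto_integral_at_top[OF _ integrable_gaussian]
  by (simp add: erf_int_def[abs_def] set_lebesgue_integral_def integral_gaussian)

text \<open>Evenness of the Gaussian; it transfers the limit at plus infinity to minus
  infinity.\<close>

lemma erf_int_minus: "erf_int (- s) = sqrt pi - erf_int s"
proof -
  have "erf_int (- s) = (LINT t:{s..}|lborel. exp (- t\<^sup>2))"
    unfolding erf_int_def set_lebesgue_integral_def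
    by (subst lborel_integral_real_affine[of "-1" _ 0]) (auto simp: indicator_def intro!: Bochner_Integration.integral_cong)
  also have "\<dots> = (LINT t:{s<..}|lborel. exp (- t\<^sup>2))"
    unfolding set_lebesgue_integral_def
    by (intro integral_cong_AE) (use AE_lborel_singleton[of s] in \<open>auto simp: indicator_def elim!: eventually_mono\<close>)
  also have "erf_int s + \<dots> = (LINT t:{..s} \<union> {s<..}|lborel. exp (- t\<^sup>2))"
    unfolding erf_int_def using integrable_gaussian
    by (intro set_integral_Un[symmetric]) (auto simp: set_integrable_def intro!: integrable_mult_indicator[where 'b=real, simplified])
  also have "{..s} \<union> {s<..} = UNIV" by auto
  finally show ?thesis by (simp add: integral_gaussian set_lebesgue_integral_def)
qed

lemma erf_int_at_bot: "(erf_int \<longlongrightarrow> 0) at_bot"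
proof -
  have "((\<lambda>s. sqrt pi - erf_int (- s)) \<longlongrightarrow> sqrt pi - sqrt pi) at_bot"
    by (intro tendsto_diff tendsto_const filterlim_compose[OF erf_int_at_top] filterlim_uminus_at_top_at_bot)
  then show ?thesis by (simp add: erf_int_minus)
qed

lemma erf_int_deriv: "(erf_int has_real_derivative exp (- s\<^sup>2)) (at s)"
proof -
  \<comment> \<open>The fundamental theorem is applied on a compact interval around
    \<open>s\<close>, so the tail up to \<open>s - 1\<close> is split off as a constant.\<close>
  have eq: "erf_int x = erf_int (s - 1) + integral {s - 1..x} (\<lambda>t. exp (- t\<^sup>2))" if "x > s - 1" for x
  proof -
    have "erf_int x = (LINT t:{..s - 1} \<union> {s - 1<..x}|lborel. exp (- t\<^sup>2))"
      unfolding erf_int_def using that by (intro arg_cong2[where f = "\<lambda>A f. set_lebesgue_integral lborel A f"]) auto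
    also have "\<dots> = erf_int (s - 1) + (LINT t:{s - 1<..x}|lborel. exp (- t\<^sup>2))"
      unfolding erf_int_def using integrable_gaussian
      by (intro set_integral_Un) (auto simp: set_integrable_def intro!: integrable_mult_indicator[where 'b=real, simplified])
    also have "(LINT t:{s - 1<..x}|lborel. exp (- t\<^sup>2)) = (LINT t:{s - 1..x}|lborel. exp (- t\<^sup>2))"
      unfolding set_lebesgue_integral_def
      by (intro integral_cong_AE) (use AE_lborel_singleton[of "s - 1"] in \<open>auto simp: indicator_def elim!: eventually_mono\<close>)
    also have "\<dots> = integral {s - 1..x} (\<lambda>t. exp (- t\<^sup>2))"
      using integrable_gaussian
      by (intro set_borel_integral_eq_integral) (auto simp: set_integrable_def intro!: integrable_mult_indicator[where 'b=real, simplified])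
    finally show ?thesis .
  qed
  have "((\<lambda>x. integral {s - 1..x} (\<lambda>t. exp (- t\<^sup>2))) has_real_derivative exp (- s\<^sup>2)) (at s within {s - 1..s + 1})"
    by (intro integral_has_real_derivative continuous_intros) auto
  then have "((\<lambda>x. integral {s - 1..x} (\<lambda>t. exp (- t\<^sup>2))) has_real_derivative exp (- s\<^sup>2)) (at s)"
    by (simp add: at_within_Icc_at)
  then have "((\<lambda>x. erf_int (s - 1) + integral {s - 1..x} (\<lambda>t. exp (- t\<^sup>2))) has_real_derivative exp (- s\<^sup>2)) (at s)"
    by (auto intro!: derivative_eq_intros)
  then show ?thesis
    by (rule has_field_derivative_transform_within_open[where S = "{s - 1<..}"]) (auto simp: eq)
qed

text \<open>The antiderivative comes from
  \<open>u + c\<^sup>2 / u = (sqrt u - c / sqrt u)\<^sup>2 + 2 * c = (sqrt u + c / sqrt u)\<^sup>2 - 2 * c\<close>.\<close>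
lemma exp_subordination:
  assumes c: "c > 0"
  shows "set_integrable lborel {0<..} (\<lambda>u. exp (- u - c\<^sup>2 / u) / sqrt u)"
    and "(LINT u:{0<..}|lborel. exp (- u - c\<^sup>2 / u) / sqrt u) = sqrt pi * exp (- 2 * c)"
proof -
  have E: "einterval 0 \<infinity> = {0<..}" by (auto simp: einterval_def)
  let ?F = "\<lambda>u. exp (- 2 * c) * erf_int (sqrt u - c / sqrt u) + exp (2 * c) * erf_int (sqrt u + c / sqrt u)"
  let ?f = "\<lambda>u. exp (- u - c\<^sup>2 / u) / sqrt u"
  have D: "DERIV ?F u :> ?f u" if "u > 0" for u
  proof -
    have e1: "exp (- 2 * c) * exp (- (sqrt u - c / sqrt u)\<^sup>2) = exp (- u - c\<^sup>2 / u)"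
      unfolding mult_exp_exp using that by (simp add: power2_diff power_divide)
    have e2: "exp (2 * c) * exp (- (sqrt u + c / sqrt u)\<^sup>2) = exp (- u - c\<^sup>2 / u)"
      unfolding mult_exp_exp using that by (simp add: power2_sum power_divide)
    have d1: "((\<lambda>u. sqrt u - c / sqrt u) has_real_derivative (1 + c / u) / (2 * sqrt u)) (at u)"
      using that by (auto intro!: derivative_eq_intros simp: field_simps)
    have d2: "((\<lambda>u. sqrt u + c / sqrt u) has_real_derivative (1 - c / u) / (2 * sqrt u)) (at u)"
      using that by (auto intro!: derivative_eq_intros simp: field_simps)
    have "DERIV ?F u :> exp (- 2 * c) * (exp (- (sqrt u - c / sqrt u)\<^sup>2) * ((1 + c / u) / (2 * sqrt u))) +
        exp (2 * c) * (exp (- (sqrt u + c / sqrt u)\<^sup>2) * ((1 - c / u) / (2 * sqrt u)))"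
      by (intro DERIV_add DERIV_cmult DERIV_chain2[OF erf_int_deriv] d1 d2)
    \<comment> \<open>By \<open>e1\<close> and \<open>e2\<close> both exponentials coincide, and the
      terms in \<open>c / u\<close> of the two inner derivatives cancel, leaving
      \<open>1 / sqrt u\<close>.\<close>
    also have "exp (- 2 * c) * (exp (- (sqrt u - c / sqrt u)\<^sup>2) * ((1 + c / u) / (2 * sqrt u))) +
        exp (2 * c) * (exp (- (sqrt u + c / sqrt u)\<^sup>2) * ((1 - c / u) / (2 * sqrt u))) = ?f u"
      unfolding mult.assoc[symmetric] e1 e2 using that by (simp add: field_simps)
    finally show ?thesis .
  qed
  \<comment> \<open>As \<open>u\<close> tends to 0 the two arguments go to minus and plus infinity;
    as \<open>u\<close> grows both go to plus infinity. The \<open>exp (2 * c)\<close> term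
    therefore has equal limits at both ends and drops out of the difference.\<close>
  have lim0: "((\<lambda>u. ?F u) \<longlongrightarrow> exp (- 2 * c) * 0 + exp (2 * c) * sqrt pi) (at_right 0)"
    by (intro tendsto_intros filterlim_compose[OF erf_int_at_bot] filterlim_compose[OF erf_int_at_top]) (use c in real_asymp)+
  have liminf: "((\<lambda>u. ?F u) \<longlongrightarrow> exp (- 2 * c) * sqrt pi + exp (2 * c) * sqrt pi) at_top"
    by (intro tendsto_intros filterlim_compose[OF erf_int_at_top]) (use c in real_asymp)+
  have "set_integrable lborel (einterval 0 \<infinity>) ?f \<and>
    (LBINT u=0..\<infinity>. ?f u) = exp (- 2 * c) * sqrt pi + exp (2 * c) * sqrt pi - (exp (- 2 * c) * 0 + exp (2 * c) * sqrt pi)"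
  proof (intro conjI interval_integral_FTC_nonneg[where F = ?F])
    show "((?F \<circ> real_of_ereal) \<longlongrightarrow> exp (- 2 * c) * 0 + exp (2 * c) * sqrt pi) (at_right 0)"
      using lim0 unfolding zero_ereal_def ereal_tendsto_simps .
    show "((?F \<circ> real_of_ereal) \<longlongrightarrow> exp (- 2 * c) * sqrt pi + exp (2 * c) * sqrt pi) (at_left \<infinity>)"
      using liminf unfolding ereal_tendsto_simps .
    then show "((?F \<circ> real_of_ereal) \<longlongrightarrow> exp (- 2 * c) * sqrt pi + exp (2 * c) * sqrt pi) (at_left \<infinity>)" .
    show "((?F \<circ> real_of_ereal) \<longlongrightarrow> exp (- 2 * c) * 0 + exp (2 * c) * sqrt pi) (at_right 0)"
      using lim0 unfolding zero_ereal_def ereal_tendsto_simps .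
  qed (use D in \<open>auto intro!: continuous_intros\<close>)
  then show "set_integrable lborel {0<..} ?f" "(LINT u:{0<..}|lborel. ?f u) = sqrt pi * exp (- 2 * c)"
    by (simp_all add: interval_lebesgue_integral_def E)
qed

text \<open>The substitution \<open>t = A * u\<close> in Euler's integral. Done with nonnegative
  integrals, it yields integrability and the value together.\<close>

lemma Gamma_integral_scaled:
  assumes "z > 0" "A > (0::real)"
  shows "set_integrable lborel {0<..} (\<lambda>u. u powr (z - 1) * exp (- A * u))" (is ?I)
    and "(LINT u:{0<..}|lborel. u powr (z - 1) * exp (- A * u)) = Gamma z / A powr z" (is ?E)
proof -
  let ?g = "\<lambda>u. indicator {0<..} u * (u powr (z - 1) * exp (- A * u))"
  let ?h = "\<lambda>t. ennreal (indicator {0..} t * t powr (z - 1) / exp t)"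
  have pt: "?h (0 + A * u) = ennreal (A powr (z - 1)) * ennreal (?g u)" for u
    using assms by (auto simp: indicator_def zero_le_mult_iff exp_minus field_simps powr_mult simp flip: ennreal_mult)
  have "ennreal (Gamma z) = (\<integral>\<^sup>+t. ?h t \<partial>lborel)"
    using Gamma_conv_nn_integral_real[OF assms(1)] .
  also have "\<dots> = \<bar>A\<bar> * (\<integral>\<^sup>+u. ?h (0 + A * u) \<partial>lborel)"
    using assms by (intro nn_integral_real_affine) auto
  also have "\<dots> = ennreal (A powr z) * (\<integral>\<^sup>+u. ennreal (?g u) \<partial>lborel)"
    unfolding pt using assms
    by (subst nn_integral_cmult) (auto simp: mult.assoc[symmetric] powr_mult_base simp flip: ennreal_mult)
  finally have "ennreal (1 / A powr z) * ennreal (Gamma z) =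
      ennreal (1 / A powr z) * ennreal (A powr z) * (\<integral>\<^sup>+u. ennreal (?g u) \<partial>lborel)"
    by (simp only: mult.assoc)
  then have nn: "(\<integral>\<^sup>+u. ennreal (?g u) \<partial>lborel) = ennreal (Gamma z / A powr z)"
    using assms by (simp flip: ennreal_mult')
  then show ?I ?E
    unfolding set_integrable_def set_lebesgue_integral_def using assms
    by (auto intro!: integrableI_nonneg simp: integral_eq_nn_integral Gamma_real_nonneg)
qed

section \<open>Fourier transforms of Gaussians and the Poisson kernel\<close>

text \<open>A rescaled characteristic function of the standard normal law:
  \<open>c = sqrt (2 * a)\<close> turns \<open>x\<^sup>2 / 2\<close> into
  \<open>a * t\<^sup>2\<close> under \<open>x = c * t\<close>, and \<open>u\<close> is chosen so
  that \<open>u * c = 2 * pi * v\<close>.\<close>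

lemma gaussian_fourier_real:
  fixes a v :: real
  assumes "a > 0"
  shows "integrable lborel (\<lambda>t::real. exp (2 * \<i> * pi * complex_of_real (v * t)) * exp (- complex_of_real (a * t\<^sup>2)))" (is "integrable _ ?h")
    and "(LINT t|lborel. exp (2 * \<i> * pi * complex_of_real (v * t)) * exp (- complex_of_real (a * t\<^sup>2))) =
      complex_of_real (sqrt (pi / a) * exp (- pi\<^sup>2 * v\<^sup>2 / a))"
proof -
  define c where "c = sqrt (2 * a)"
  have c: "c > 0" "c\<^sup>2 = 2 * a" using assms by (auto simp: c_def)
  define u where "u = 2 * pi * v / c"
  let ?g = "\<lambda>x. std_normal_density x *\<^sub>R iexp (u * x)"
  have gi: "integrable lborel ?g"
    by (rule Bochner_Integration.integrable_bound[OF integrable_normal_density[of 1 0]]) auto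
  have ge: "(LINT x|lborel. ?g x) = complex_of_real (exp (- u\<^sup>2 / 2))"
    using fun_cong[OF char_std_normal_distribution, of u]
    unfolding char_def by (subst (asm) integral_density) auto
  have gh: "?g (0 + c * t) = complex_of_real (1 / sqrt (2 * pi)) * ?h t" for t
  proof -
    have "(c * t)\<^sup>2 / 2 = a * t\<^sup>2" using c by (simp add: power_mult_distrib)
    moreover have "u * (c * t) = 2 * pi * v * t" using c by (simp add: u_def)
    then have "\<i> * complex_of_real (u * (c * t)) = 2 * \<i> * pi * complex_of_real (v * t)" by (simp only:) simp
    then have "iexp (u * (c * t)) = exp (2 * \<i> * pi * complex_of_real (v * t))" by (simp only:)
    ultimately show ?thesis
      by (simp add: std_normal_density_def scaleR_conv_of_real of_real_exp)
  qed
  have "integrable lborel (\<lambda>t. complex_of_real (1 / sqrt (2 * pi)) * ?h t)"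
    using lborel_integrable_real_affine[OF gi, of c 0] c(1) unfolding gh by simp
  from integrable_mult_right[OF this, of "complex_of_real (sqrt (2 * pi))"]
  show hi: "integrable lborel ?h" by (simp add: mult.assoc[symmetric] flip: of_real_mult)
  have "complex_of_real (exp (- u\<^sup>2 / 2)) = c *\<^sub>R (LINT t|lborel. complex_of_real (1 / sqrt (2 * pi)) * ?h t)"
    unfolding ge[symmetric] using lborel_integral_real_affine[of c ?g 0] c(1) unfolding gh by simp
  also have "\<dots> = complex_of_real (c / sqrt (2 * pi)) * (LINT t|lborel. ?h t)"
    by (simp add: scaleR_conv_of_real)
  finally have "complex_of_real (sqrt (2 * pi) / c * (c / sqrt (2 * pi))) * (LINT t|lborel. ?h t) = 
      complex_of_real (sqrt (2 * pi) / c * exp (- u\<^sup>2 / 2))" by (simp add: mult.assoc)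
  moreover have "sqrt (2 * pi) / c * (c / sqrt (2 * pi)) = 1" using c(1) by simp
  moreover have "sqrt (2 * pi) / c = sqrt (pi / a)" using assms by (simp add: c_def real_sqrt_divide real_sqrt_mult)
  moreover have "- u\<^sup>2 / 2 = - pi\<^sup>2 * v\<^sup>2 / a" using assms by (simp add: u_def power_divide power_mult_distrib c)
  ultimately show "(LINT t|lborel. ?h t) = complex_of_real (sqrt (pi / a) * exp (- pi\<^sup>2 * v\<^sup>2 / a))"
    using assms c(1) by simp
qed

lemma gaussian_fourier:
  fixes v :: "'a::euclidean_space"
  assumes a: "a > 0"
  shows "integrable lborel (\<lambda>\<xi>. exp (2 * \<i> * pi * complex_of_real (v \<bullet> \<xi>)) * exp (- complex_of_real (a * (norm \<xi>)\<^sup>2)))" (is "integrable _ ?h")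
    and "(LINT \<xi>|lborel. exp (2 * \<i> * pi * complex_of_real (v \<bullet> \<xi>)) * exp (- complex_of_real (a * (norm \<xi>)\<^sup>2))) =
      complex_of_real (sqrt (pi / a) ^ DIM('a) * exp (- pi\<^sup>2 * (norm v)\<^sup>2 / a))"
proof -
  let ?L = "\<lambda>c. \<Sum>b\<in>Basis. c b *\<^sub>R b :: 'a"
  let ?P = "Pi\<^sub>M (Basis :: 'a set) (\<lambda>_. lborel :: real measure)"
  define g where "g b t = exp (2 * \<i> * pi * complex_of_real ((v \<bullet> b) * t)) * exp (- complex_of_real (a * t\<^sup>2))" for b t
  have prod: "?h (?L c) = (\<Prod>b\<in>Basis. g b (c b))" for c
  proof -
    have "2 * \<i> * pi * complex_of_real (v \<bullet> ?L c) = (\<Sum>b\<in>Basis. 2 * \<i> * pi * complex_of_real ((v \<bullet> b) * c b))"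
      by (simp add: inner_sum_right sum_distrib_left mult_ac)
    moreover have "- complex_of_real (a * (norm (?L c))\<^sup>2) = (\<Sum>b\<in>Basis. - complex_of_real (a * (c b)\<^sup>2))"
      by (simp add: norm_sum_orthonormal[OF orthonormal_basis_of_Basis] sum_distrib_left sum_negf)
    ultimately show ?thesis
      by (simp only: exp_sum[OF finite_Basis] g_def prod.distrib)
  qed
  have gi: "integrable lborel (g b)" for b
    unfolding g_def[abs_def] by (rule gaussian_fourier_real(1)[OF a])
  have "integrable ?P (\<lambda>c. \<Prod>b\<in>Basis. g b (c b))"
    by (rule lborel_PiM.product_integrable_prod) (auto intro: gi)
  then show "integrable lborel ?h"
    by (subst lborel_eq, subst integrable_distr_eq) (simp_all only: prod, measurable)
  have "(LINT \<xi>|lborel. ?h \<xi>) = (LINT c|?P. (\<Prod>b\<in>Basis. g b (c b)))"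
    by (subst lborel_eq, subst integral_distr) (simp_all only: prod, measurable)
  also have "\<dots> = (\<Prod>b\<in>Basis. LINT t|lborel. g b t)"
    by (rule lborel_PiM.product_integral_prod) (auto intro: gi)
  also have "\<dots> = (\<Prod>b\<in>Basis. complex_of_real (sqrt (pi / a) * exp (- pi\<^sup>2 * (v \<bullet> b)\<^sup>2 / a)))"
    unfolding g_def by (simp only: gaussian_fourier_real(2)[OF a])
  also have "\<dots> = complex_of_real (sqrt (pi / a) ^ DIM('a) * (\<Prod>b\<in>Basis. exp (- pi\<^sup>2 * (v \<bullet> b)\<^sup>2 / a)))"
    by (simp add: prod.distrib)
  also have "(\<Prod>b\<in>Basis. exp (- pi\<^sup>2 * (v \<bullet> b)\<^sup>2 / a)) = exp (- pi\<^sup>2 * (norm v)\<^sup>2 / a)"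
  proof -
    have "(norm v)\<^sup>2 = (\<Sum>b\<in>Basis. (v \<bullet> b)\<^sup>2)"
      unfolding power2_norm_eq_inner by (subst euclidean_inner) (simp add: power2_eq_square)
    then show ?thesis
      by (simp add: exp_sum[symmetric] sum_distrib_left sum_divide_distrib)
  qed
  finally show "(LINT \<xi>|lborel. ?h \<xi>) = complex_of_real (sqrt (pi / a) ^ DIM('a) * exp (- pi\<^sup>2 * (norm v)\<^sup>2 / a))" .
qed

lemma gaussian_integral:
  assumes a: "a > 0"
  shows "integrable lborel (\<lambda>\<xi>::'a::euclidean_space. exp (- (a * (norm \<xi>)\<^sup>2)))"
    and "(LINT \<xi>|lborel. exp (- (a * (norm (\<xi>::'a))\<^sup>2))) = sqrt (pi / a) ^ DIM('a)"
proof -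
  have *: "exp (2 * \<i> * pi * complex_of_real ((0::'a) \<bullet> \<xi>)) * exp (- complex_of_real (a * (norm \<xi>)\<^sup>2)) =
      complex_of_real (exp (- (a * (norm \<xi>)\<^sup>2)))" for \<xi> :: 'a
    by (simp add: of_real_exp)
  show "integrable lborel (\<lambda>\<xi>::'a::euclidean_space. exp (- (a * (norm \<xi>)\<^sup>2)))"
    using integrable_Re[OF gaussian_fourier(1)[OF a, of "0::'a"]] unfolding * by (simp only: Re_complex_of_real)
  have "complex_of_real (LINT \<xi>|lborel. exp (- (a * (norm (\<xi>::'a))\<^sup>2))) = complex_of_real (sqrt (pi / a) ^ DIM('a))"
    using gaussian_fourier(2)[OF a, of "0::'a"] unfolding * by (simp add: integral_complex_of_real)
  then show "(LINT \<xi>|lborel. exp (- (a * (norm (\<xi>::'a))\<^sup>2))) = sqrt (pi / a) ^ DIM('a)"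
    by (simp only: of_real_eq_iff)
qed

text \<open>The left-hand side is the shape in which the Gamma integral delivers the kernel. The
  identity extracts \<open>(y\<^sup>2) powr z = y ^ (n + 1)\<close> and collects the half-integer
  powers of \<open>pi\<close>, with \<open>z = (n + 1) / 2\<close>.\<close>

lemma poisson_kernel_altdef:
  fixes v :: "'a::euclidean_space"
  assumes y: "y > 0"
  shows "Gamma ((real DIM('a) + 1) / 2) / (1 + (norm v)\<^sup>2 / y\<^sup>2) powr ((real DIM('a) + 1) / 2) /
      (sqrt pi * (sqrt pi * y) ^ DIM('a)) = poisson_kernel y v"
proof -
  define z where "z = (real DIM('a) + 1) / 2"
  have "(1 + (norm v)\<^sup>2 / y\<^sup>2) powr z = ((norm v)\<^sup>2 + y\<^sup>2) powr z / (y\<^sup>2) powr z"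
    using y by (subst powr_divide[symmetric]) (auto simp: field_simps)
  moreover have "(y\<^sup>2) powr z = y ^ DIM('a) * y"
  proof -
    have "2 * z = real (DIM('a) + 1)" by (simp add: z_def field_simps)
    then have "(y\<^sup>2) powr z = y powr real (DIM('a) + 1)"
      using y by (metis less_imp_le powr_numeral powr_powr)
    also have "\<dots> = y ^ DIM('a) * y" using y by (subst powr_realpow) auto
    finally show ?thesis .
  qed
  moreover have "pi powr z = sqrt pi * sqrt pi ^ DIM('a)"
  proof -
    have "sqrt pi * sqrt pi ^ DIM('a) = sqrt pi powr real (DIM('a) + 1)"
      by (subst powr_realpow) auto
    also have "\<dots> = pi powr z"
      by (simp add: powr_half_sqrt[symmetric] powr_powr z_def add.commute)
    finally show ?thesis ..
  qed
  ultimately show ?thesis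
    using y unfolding poisson_kernel_def z_def[symmetric]
    by (simp add: power_mult_distrib field_simps)
qed

text \<open>Subordination with \<open>c = pi * norm \<xi> * y\<close> makes the exponential a
  mixture, over \<open>u\<close>, of Gaussians in \<open>\<xi>\<close> with parameter
  \<open>pi\<^sup>2 * y\<^sup>2 / u\<close>. Transforming each Gaussian contributes
  \<open>exp (- (norm v)\<^sup>2 / y\<^sup>2 * u)\<close>, and what remains in \<open>u\<close> is a
  Gamma integral with rate \<open>1 + (norm v)\<^sup>2 / y\<^sup>2\<close>.\<close>

lemma inverse_fourier_exp_norm:
  fixes v :: "'a::euclidean_space"
  assumes y: "y > 0"
  shows "integrable lborel (\<lambda>\<xi>. exp (2 * \<i> * pi * complex_of_real (v \<bullet> \<xi>)) * exp (- complex_of_real (2 * pi * norm \<xi> * y)))"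
      (is "integrable _ ?h")
    and "(LINT \<xi>|lborel. exp (2 * \<i> * pi * complex_of_real (v \<bullet> \<xi>)) * exp (- complex_of_real (2 * pi * norm \<xi> * y))) =
      complex_of_real (poisson_kernel y v)"
proof -
  define n where "n = DIM('a)"
  define z where "z = (real n + 1) / 2"
  define K where "K = 1 / (sqrt pi * (sqrt pi * y) ^ n)"
  define w where "w u = indicator {0<..} u * (exp (- u) / sqrt u) / sqrt pi" for u :: real
  define G where "G = (\<lambda>(u, \<xi>::'a). complex_of_real (w u) *
    (exp (2 * \<i> * pi * complex_of_real (v \<bullet> \<xi>)) * exp (- complex_of_real (pi\<^sup>2 * y\<^sup>2 / u * (norm \<xi>)\<^sup>2))))"
  \<comment> \<open>Weight times Gaussian mass: \<open>sqrt u ^ n\<close> from the mass and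
    \<open>1 / sqrt u\<close> from the weight combine to the Gamma exponent
    \<open>z - 1 = (n - 1) / 2\<close>.\<close>
  have wG: "w u * sqrt (pi / (pi\<^sup>2 * y\<^sup>2 / u)) ^ n = K * (indicator {0<..} u * (u powr (z - 1) * exp (- u)))" for u
  proof (cases "u > 0")
    case True
    have "sqrt u ^ n / sqrt u = u powr (z - 1)"
    proof -
      have "sqrt u ^ n / sqrt u = sqrt u powr (real n - 1)"
        using True by (simp add: powr_diff powr_realpow)
      also have "\<dots> = u powr (z - 1)"
        using True by (simp add: powr_half_sqrt[symmetric] powr_powr z_def field_simps)
      finally show ?thesis .
    qed
    moreover have "sqrt (pi / (pi\<^sup>2 * y\<^sup>2 / u)) = sqrt u / (sqrt pi * y)"
      using y True by (simp add: power2_eq_square real_sqrt_divide real_sqrt_mult)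
    ultimately show ?thesis
      using True by (simp add: w_def K_def power_divide field_simps)
  qed (simp add: w_def)
  have a: "pi\<^sup>2 * y\<^sup>2 / u > 0" if "u > 0" for u using that y by simp
  have w0: "w u = 0" if "\<not> u > 0" for u using that by (simp add: w_def)
  have wnn: "w u \<ge> 0" for u by (cases "u > 0") (simp_all add: w_def)
  have [measurable]: "w \<in> borel_measurable borel" unfolding w_def[abs_def] by measurable
  have Gm [measurable]: "G \<in> borel_measurable (lborel \<Otimes>\<^sub>M lborel)" unfolding G_def by measurable
  have Gi: "integrable (lborel \<Otimes>\<^sub>M lborel) G"
  proof (rule lborel_pair.Fubini_integrable[OF Gm])
    \<comment> \<open>Taking norms removes the oscillating factor, so the remaining
      \<open>u\<close>-integral is the Gamma integral with rate 1.\<close>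
    have "(LINT \<xi>|lborel. norm (G (u, \<xi>))) = K * (indicator {0<..} u * (u powr (z - 1) * exp (- 1 * u)))" for u
    proof -
      have "norm (G (u, \<xi>)) = w u * exp (- (pi\<^sup>2 * y\<^sup>2 / u * (norm \<xi>)\<^sup>2))" for \<xi>
        using wnn[of u] by (simp add: G_def norm_mult)
      then have "(LINT \<xi>|lborel. norm (G (u, \<xi>))) = w u * (LINT \<xi>|lborel. exp (- (pi\<^sup>2 * y\<^sup>2 / u * (norm (\<xi>::'a))\<^sup>2)))"
        by (simp only: integral_mult_right_zero)
      also have "\<dots> = w u * sqrt (pi / (pi\<^sup>2 * y\<^sup>2 / u)) ^ n"
        using gaussian_integral(2)[OF a, of u, where 'a = 'a] w0[of u] by (cases "u > 0") (auto simp: n_def)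
      finally show ?thesis unfolding wG by simp
    qed
    then show "integrable lborel (\<lambda>u. LINT \<xi>|lborel. norm (G (u, \<xi>)))"
      using Gamma_integral_scaled(1)[of z 1] by (simp add: set_integrable_def z_def)
    show "AE u in lborel. integrable lborel (\<lambda>\<xi>. G (u, \<xi>))"
    proof (rule AE_I2)
      fix u
      show "integrable lborel (\<lambda>\<xi>. G (u, \<xi>))"
        using gaussian_fourier(1)[OF a, of u v] w0[of u] unfolding G_def prod.case
        by (cases "u > 0") (simp_all only: of_real_0 mult_zero_left integrable_zero integrable_mult_right not_False_eq_True)
    qed
  qed
  \<comment> \<open>The origin is left out because subordination requires \<open>c > 0\<close>; a
    single point is negligible.\<close>
  have inner: "(LINT u|lborel. G (u, \<xi>)) = ?h \<xi>" if "\<xi> \<noteq> 0" for \<xi>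
  proof -
    let ?c = "pi * norm \<xi> * y"
    have c: "?c > 0" using that y by simp
    have "G (u, \<xi>) = exp (2 * \<i> * pi * complex_of_real (v \<bullet> \<xi>)) *
        complex_of_real (indicator {0<..} u *\<^sub>R (exp (- u - ?c\<^sup>2 / u) / sqrt u) / sqrt pi)" for u
    proof (cases "u > 0")
      case True
      define X where "X = pi\<^sup>2 * y\<^sup>2 / u * (norm \<xi>)\<^sup>2"
      have "- u - ?c\<^sup>2 / u = - u + - X" by (simp add: X_def power_mult_distrib)
      then have "exp (- u - ?c\<^sup>2 / u) = exp (- u) * exp (- X)" by (simp only: exp_add)
      moreover have "exp (- complex_of_real X) = complex_of_real (exp (- X))" by (simp add: of_real_exp)
      ultimately show ?thesis
        using True unfolding G_def w_def prod.case X_def[symmetric] by simp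
    qed (simp add: G_def w_def)
    then have "(LINT u|lborel. G (u, \<xi>)) = exp (2 * \<i> * pi * complex_of_real (v \<bullet> \<xi>)) *
        complex_of_real ((LINT u:{0<..}|lborel. exp (- u - ?c\<^sup>2 / u) / sqrt u) / sqrt pi)"
      by (simp only: integral_mult_right_zero integral_complex_of_real integral_divide_zero set_lebesgue_integral_def)
    then show ?thesis
      unfolding exp_subordination(2)[OF c] by (simp add: of_real_exp mult_ac)
  qed
  have ae: "AE \<xi> in lborel. (LINT u|lborel. G (u, \<xi>)) = ?h \<xi>"
    using AE_lborel_singleton[of 0] by eventually_elim (rule inner)
  have Gi': "integrable (lborel \<Otimes>\<^sub>M lborel) (case_prod (\<lambda>u \<xi>. G (u, \<xi>)))"
    using Gi by (simp add: case_prod_unfold)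
  have Gu: "integrable lborel (\<lambda>\<xi>. LINT u|lborel. G (u, \<xi>))"
    by (rule lborel_pair.integrable_snd[OF Gi'])
  show "integrable lborel ?h"
    by (rule integrable_cong_AE_imp[OF Gu]) (use ae in \<open>auto elim: eventually_mono\<close>)
  have "(LINT \<xi>|lborel. ?h \<xi>) = (LINT \<xi>|lborel. LINT u|lborel. G (u, \<xi>))"
    using Gu by (intro integral_cong_AE) (use ae in \<open>auto elim: eventually_mono\<close>)
  also have "\<dots> = (LINT u|lborel. LINT \<xi>|lborel. G (u, \<xi>))"
    by (rule lborel_pair.Fubini_integral[OF Gi'])
  also have "\<dots> = (LINT u|lborel. complex_of_real (K * (indicator {0<..} u *\<^sub>R (u powr (z - 1) * exp (- (1 + (norm v)\<^sup>2 / y\<^sup>2) * u)))))"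
  proof (rule Bochner_Integration.integral_cong[OF refl])
    fix u
    show "(LINT \<xi>|lborel. G (u, \<xi>)) =
      complex_of_real (K * (indicator {0<..} u *\<^sub>R (u powr (z - 1) * exp (- (1 + (norm v)\<^sup>2 / y\<^sup>2) * u))))"
    proof (cases "u > 0")
      case True
      have "(LINT \<xi>|lborel. G (u, \<xi>)) = complex_of_real (w u) *
        complex_of_real (sqrt (pi / (pi\<^sup>2 * y\<^sup>2 / u)) ^ n * exp (- pi\<^sup>2 * (norm v)\<^sup>2 / (pi\<^sup>2 * y\<^sup>2 / u)))"
        unfolding G_def prod.case integral_mult_right_zero gaussian_fourier(2)[OF a[OF True]] n_def ..
      also have "\<dots> = complex_of_real ((w u * sqrt (pi / (pi\<^sup>2 * y\<^sup>2 / u)) ^ n) * exp (- pi\<^sup>2 * (norm v)\<^sup>2 / (pi\<^sup>2 * y\<^sup>2 / u)))"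
        by (simp only: of_real_mult mult.assoc)
      also have "- pi\<^sup>2 * (norm v)\<^sup>2 / (pi\<^sup>2 * y\<^sup>2 / u) = - ((norm v)\<^sup>2 / y\<^sup>2 * u)" using y True by (simp add: field_simps)
      also have "(w u * sqrt (pi / (pi\<^sup>2 * y\<^sup>2 / u)) ^ n) * exp (- ((norm v)\<^sup>2 / y\<^sup>2 * u)) =
        K * (indicator {0<..} u *\<^sub>R (u powr (z - 1) * exp (- (1 + (norm v)\<^sup>2 / y\<^sup>2) * u)))"
        unfolding wG by (simp add: distrib_right exp_add[symmetric] algebra_simps)
      finally show ?thesis .
    qed (simp add: G_def w0)
  qed
  also have "\<dots> = complex_of_real (K * (LINT u:{0<..}|lborel. u powr (z - 1) * exp (- (1 + (norm v)\<^sup>2 / y\<^sup>2) * u)))"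
    by (simp only: integral_complex_of_real integral_mult_right_zero set_lebesgue_integral_def)
  also have "(LINT u:{0<..}|lborel. u powr (z - 1) * exp (- (1 + (norm v)\<^sup>2 / y\<^sup>2) * u)) =
      Gamma z / (1 + (norm v)\<^sup>2 / y\<^sup>2) powr z"
    by (rule Gamma_integral_scaled(2)) (auto simp: z_def intro: add_pos_nonneg)
  also have "K * (Gamma z / (1 + (norm v)\<^sup>2 / y\<^sup>2) powr z) = poisson_kernel y v"
    using poisson_kernel_altdef[OF y, of v] by (simp add: K_def z_def n_def mult.commute)
  finally show "(LINT \<xi>|lborel. ?h \<xi>) = complex_of_real (poisson_kernel y v)" .
qed

section \<open>The directional decomposition\<close>

text \<open>Justifies both exchanges of integrals against \<open>f'\<close>: over radii, where
  \<open>g\<close> decays exponentially, and over the sphere, where \<open>g\<close> is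
  constant.\<close>

lemma integrable_pair_mult:
  fixes f :: "'a \<Rightarrow> complex" and g :: "'b \<Rightarrow> real" and K :: "'a \<times> 'b \<Rightarrow> complex"
  assumes "pair_sigma_finite M N" and f: "integrable M f" and g: "integrable N g"
    and [measurable]: "K \<in> borel_measurable (M \<Otimes>\<^sub>M N)"
    and K: "\<And>x y. x \<in> space M \<Longrightarrow> y \<in> space N \<Longrightarrow> norm (K (x, y)) \<le> norm (f x) * g y"
  shows "integrable (M \<Otimes>\<^sub>M N) K"
proof -
  interpret pair_sigma_finite M N by fact
  have [measurable]: "f \<in> borel_measurable M" "g \<in> borel_measurable N" using f g by auto
  have "integrable (M \<Otimes>\<^sub>M N) (\<lambda>(x, y). norm (f x) * g y)"
    by (rule Fubini_integrable) (use f g in \<open>auto simp: norm_mult abs_mult intro!: integrable_mult_left\<close>)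
  then show ?thesis
    by (rule Bochner_Integration.integrable_bound)
      (use K in \<open>auto simp: space_pair_measure intro!: AE_I2 intro: order_trans[OF _ abs_ge_self]\<close>)
qed

text \<open>For \<open>Im s < 0\<close> and \<open>n > 0\<close> this is the integral of
  \<open>exp (- 2 * \<i> * pi * s * r) * r ^ (n - 1)\<close> over \<open>r > 0\<close>.\<close>

definition sphere_kernel :: "nat \<Rightarrow> complex \<Rightarrow> complex" where
  "sphere_kernel n s = fact (n - 1) / (2 * \<i> * pi * s) ^ n"

lemma sphere_kernel_altdef:
  "sphere_kernel n s = fact (n - 1) / (2 * \<i> * pi) ^ n * (1 / s ^ n)"
  by (simp add: sphere_kernel_def power_mult_distrib)

lemma Re_two_pi_i_mult: "Re (2 * \<i> * pi * (complex_of_real t - z)) = 2 * pi * Im z"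
  by simp

text \<open>The modulus of the denominator's base is at least its real part
  \<open>2 * pi * Im z\<close>, which does not depend on \<open>t\<close>. Such a uniform bound is
  what an \<open>f\<close> that is merely integrable calls for.\<close>

lemma norm_sphere_kernel_le:
  assumes "Im z > 0"
  shows "norm (sphere_kernel n (complex_of_real t - z)) \<le> fact (n - 1) / (2 * pi * Im z) ^ n"
proof -
  have "2 * pi * Im z \<le> norm (2 * \<i> * pi * (complex_of_real t - z))"
    using complex_Re_le_cmod[of "2 * \<i> * pi * (complex_of_real t - z)"] unfolding Re_two_pi_i_mult .
  then have "(2 * pi * Im z) ^ n \<le> norm (2 * \<i> * pi * (complex_of_real t - z)) ^ n"
    using assms by (intro power_mono) auto
  moreover have "(2 * pi * Im z) ^ n > 0" using assms by simp
  ultimately show ?thesis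
    unfolding sphere_kernel_def norm_divide norm_power norm_fact
    by (intro divide_left_mono) (auto intro: mult_pos_pos order_less_le_trans)
qed

lemma sphere_kernel_integral:
  assumes "Im z > 0" "n > 0"
  shows "(LINT r:{0<..}|lborel. exp (- (2 * \<i> * pi * (complex_of_real t - z) * complex_of_real r)) * complex_of_real r ^ (n - 1)) =
    sphere_kernel n (complex_of_real t - z)"
  using set_integral_exp_power[of "2 * \<i> * pi * (complex_of_real t - z)" "n - 1"] assms
  by (simp add: sphere_kernel_def Re_two_pi_i_mult)

section \<open>Integrating out the radius, then slicing or averaging over directions\<close>

lemma fourier_transform_borel:
  fixes f :: "'a::euclidean_space \<Rightarrow> complex"
  assumes [measurable]: "f' \<in> borel_measurable borel" and ae: "AE x in lborel. f x = f' x"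
  shows "fourier_transform f \<xi> = (LINT x|lborel. f' x * exp (- 2 * \<i> * pi * complex_of_real (x \<bullet> \<xi>)))"
  unfolding fourier_transform_def
  by (rule integral_completion_cong_AE) (use ae in \<open>auto elim: eventually_mono\<close>)

lemma directional_F_eq:
  fixes f :: "'a::euclidean_space \<Rightarrow> complex"
  assumes f': "integrable lborel f'" and ae: "AE x in lborel. f x = f' x" and z: "Im z > 0"
  shows "directional_F f \<theta> z = (LINT x|lborel. f' x * sphere_kernel DIM('a) (complex_of_real (x \<bullet> \<theta>) - z))"
proof -
  define n where "n = DIM('a)"
  have [measurable]: "f' \<in> borel_measurable borel" using f' by auto
  define e where "e x r = exp (- (2 * \<i> * pi * (complex_of_real (x \<bullet> \<theta>) - z) * complex_of_real r)) * complex_of_real r ^ (n - 1)" for x r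
  define K where "K x r = f' x * (indicator {0<..} r *\<^sub>R e x r)" for x r
  \<comment> \<open>The modulus of the radial factor depends on \<open>x\<close> only through a
    phase, so this one function of \<open>r\<close> dominates for all \<open>x\<close>.\<close>
  define g where "g r = norm (indicator {0<..} r *\<^sub>R (exp (- (complex_of_real (2 * pi * Im z) * complex_of_real r)) * complex_of_real r ^ (n - 1)))" for r :: real
  have gi: "integrable lborel g"
    unfolding g_def[abs_def] using set_integrable_exp_power[of "complex_of_real (2 * pi * Im z)" "n - 1"] z
    by (intro integrable_norm) (simp add: set_integrable_def)
  have "integrable (lborel \<Otimes>\<^sub>M lborel) (\<lambda>(x, r). K x r)"
  proof (rule integrable_pair_mult[OF lborel_pair.pair_sigma_finite_axioms f' gi])
    show "(\<lambda>(x, r). K x r) \<in> borel_measurable (lborel \<Otimes>\<^sub>M lborel)"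
      unfolding K_def e_def by measurable
    show "norm (case (x, r) of (x, r) \<Rightarrow> K x r) \<le> norm (f' x) * g r" for x r
      by (simp add: K_def e_def g_def norm_mult)
  qed
  note K = this
  have "directional_F f \<theta> z = (LINT r|lborel. LINT x|lborel. K x r)"
    unfolding directional_F_def set_lebesgue_integral_def
  proof (rule Bochner_Integration.integral_cong[OF refl])
    fix r :: real
    have "K x r = f' x * exp (- 2 * \<i> * pi * complex_of_real (x \<bullet> (r *\<^sub>R \<theta>))) *
        (indicator {0<..} r *\<^sub>R (exp (2 * \<i> * pi * r * z) * complex_of_real r ^ (n - 1)))" for x
    proof -
      have "- (2 * \<i> * pi * (complex_of_real (x \<bullet> \<theta>) - z) * complex_of_real r) =
        - 2 * \<i> * pi * complex_of_real (x \<bullet> (r *\<^sub>R \<theta>)) + 2 * \<i> * pi * r * z"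
        by (simp add: algebra_simps)
      then show ?thesis unfolding K_def e_def by (simp only: exp_add) simp
    qed
    then have "(LINT x|lborel. K x r) = fourier_transform f (r *\<^sub>R \<theta>) *
        (indicator {0<..} r *\<^sub>R (exp (2 * \<i> * pi * r * z) * complex_of_real r ^ (n - 1)))"
      by (simp only: integral_mult_left_zero fourier_transform_borel[OF _ ae] \<open>f' \<in> borel_measurable borel\<close>)
    then show "indicat_real {0<..} r *\<^sub>R (exp (2 * \<i> * pi * r * z) * fourier_transform f (r *\<^sub>R \<theta>) * complex_of_real (r ^ (DIM('a) - 1))) =
        (LINT x|lborel. K x r)"
      by (simp add: n_def)
  qed
  also have "\<dots> = (LINT x|lborel. LINT r|lborel. K x r)"
    by (rule lborel_pair.Fubini_integral[OF K])
  also have "\<dots> = (LINT x|lborel. f' x * sphere_kernel n (complex_of_real (x \<bullet> \<theta>) - z))"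
  proof -
    have "(LINT r|lborel. K x r) = f' x * sphere_kernel n (complex_of_real (x \<bullet> \<theta>) - z)" for x
      using sphere_kernel_integral[OF z, of n "x \<bullet> \<theta>"]
      unfolding K_def e_def integral_mult_right_zero set_lebesgue_integral_def by (simp add: n_def)
    then show ?thesis by simp
  qed
  finally show ?thesis by (simp add: n_def)
qed

lemma integrable_mult_bounded:
  fixes f g :: "'a \<Rightarrow> complex"
  assumes "integrable M f" "g \<in> borel_measurable M" "\<And>x. norm (g x) \<le> C"
  shows "integrable M (\<lambda>x. f x * g x)"
proof (rule Bochner_Integration.integrable_bound[OF integrable_mult_left[OF assms(1), of "complex_of_real C"]])
  show "AE x in M. norm (f x * g x) \<le> norm (f x * complex_of_real C)"
    using order_trans[OF norm_ge_zero assms(3)] by (auto simp: norm_mult intro!: AE_I2 mult_left_mono assms(3))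
qed (use assms in measurable)

text \<open>Fubini in the coordinates adapted to \<open>\<theta>\<close>, where
  \<open>x \<bullet> \<theta>\<close> is the first coordinate. The test function \<open>g\<close> is
  bounded so that integrability of \<open>f'\<close> passes to the product.\<close>

lemma radon_transform_slice:
  fixes f :: "'a::euclidean_space \<Rightarrow> complex"
  assumes \<theta>: "norm \<theta> = 1" and f': "integrable lborel f'" and ae: "AE x in lborel. f x = f' x"
    and g: "g \<in> borel_measurable borel" "\<And>t. norm (g t) \<le> C"
  shows "(LINT x|lborel. f' x * g (x \<bullet> \<theta>)) = (LINT t|lebesgue. radon_transform \<theta> f t * g t)"
proof -
  let ?H = "{x. \<theta> \<bullet> x = 0}"
  \<comment> \<open>The same choice as in \<open>subspace_lebesgue\<close>, so that unfolding the
    Radon transform yields literally this basis.\<close>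
  define B where "B = (SOME B. orthonormal_basis_of ?H B)"
  have B: "orthonormal_basis_of ?H B"
    unfolding B_def by (rule someI_ex, rule orthonormal_basis_of_exists) (rule subspace_hyperplane)
  have fin: "finite B" by (rule orthonormal_basis_of_independent[OF B])
  let ?P = "Pi\<^sub>M B (\<lambda>_. lborel :: real measure)"
  let ?L = "\<lambda>c. \<Sum>b\<in>B. c b *\<^sub>R b"
  let ?S = "\<lambda>(t, c). t *\<^sub>R \<theta> + ?L c"
  note S = lborel_eq_distr_hyperplane[OF \<theta> B]
  interpret P: sigma_finite_measure ?P by (intro lborel_PiM.sigma_finite fin)
  interpret LP: pair_sigma_finite "lborel :: real measure" ?P ..
  have [measurable]: "f' \<in> borel_measurable borel" "g \<in> borel_measurable borel" using f' g by auto
  have Sm [measurable]: "?S \<in> borel_measurable (lborel \<Otimes>\<^sub>M ?P)" by measurable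
  have Lm [measurable]: "?L \<in> borel_measurable ?P" by measurable
  have S\<theta>: "?S p \<bullet> \<theta> = fst p" for p
  proof -
    have "?L c \<in> span B" for c by (intro span_sum span_scale span_base)
    then have "\<theta> \<bullet> ?L c = 0" for c using B by (auto simp: orthonormal_basis_of_def)
    moreover have "?S (t, c) \<bullet> \<theta> = t * (\<theta> \<bullet> \<theta>) + \<theta> \<bullet> ?L c" for t c
      by (simp only: prod.case inner_add_left inner_scaleR_left inner_commute[of "?L c" \<theta>])
    ultimately show ?thesis
      using \<theta> by (cases p) (simp add: norm_eq_1)
  qed
  \<comment> \<open>A measurable null set covering the disagreement is needed: Fubini then makes its
    slices null for almost every \<open>t\<close>, and only for these \<open>t\<close> is the Radon
    transform compared with \<open>f'\<close>.\<close>
  obtain N where N: "\<And>x. x \<in> space lborel - N \<Longrightarrow> f x = f' x" "N \<in> null_sets lborel"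
    using AE_E3[OF ae] by blast
  have [measurable]: "N \<in> sets borel" using N(2) by auto
  have "AE x in lborel. x \<notin> N" by (rule AE_not_in[OF N(2)])
  then have "AE p in lborel \<Otimes>\<^sub>M ?P. ?S p \<notin> N"
    by (subst (asm) S, subst (asm) AE_distr_iff) auto
  then have aet: "AE t in lborel. AE c in ?P. ?S (t, c) \<notin> N"
    by (rule LP.AE_pair)
  have "radon_transform \<theta> f t = (LINT c|?P. f' (?S (t, c)))" if "AE c in ?P. ?S (t, c) \<notin> N" for t
  proof -
    have "radon_transform \<theta> f t = (LINT x|completion (distr ?P borel ?L). f (t *\<^sub>R \<theta> + x))"
      unfolding radon_transform_def subspace_lebesgue_def Let_def B_def ..
    also have "\<dots> = (LINT x|distr ?P borel ?L. f' (t *\<^sub>R \<theta> + x))"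
    proof (rule integral_completion_cong_AE)
      have "AE x in distr ?P borel ?L. t *\<^sub>R \<theta> + x \<notin> N"
        using that by (subst AE_distr_iff) auto
      then show "AE x in distr ?P borel ?L. f (t *\<^sub>R \<theta> + x) = f' (t *\<^sub>R \<theta> + x)"
        by eventually_elim (use N(1) in auto)
    qed measurable
    also have "\<dots> = (LINT c|?P. f' (?S (t, c)))"
      by (subst integral_distr) auto
    finally show ?thesis .
  qed
  with aet have aeR: "AE t in lborel. radon_transform \<theta> f t * g t = (LINT c|?P. f' (?S (t, c))) * g t"
    by (auto elim!: eventually_mono)
  have "integrable lborel (\<lambda>x. f' x * g (x \<bullet> \<theta>))"
    using f' by (rule integrable_mult_bounded) (use g in auto)
  then have "integrable (lborel \<Otimes>\<^sub>M ?P) (\<lambda>p. f' (?S p) * g (fst p))"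
    by (subst (asm) S, subst (asm) integrable_distr_eq) (simp_all only: S\<theta>, measurable)
  then have int: "integrable (lborel \<Otimes>\<^sub>M ?P) (\<lambda>(t, c). f' (?S (t, c)) * g t)"
    by (simp add: case_prod_unfold)
  have "(LINT x|lborel. f' x * g (x \<bullet> \<theta>)) = (LINT p|(lborel \<Otimes>\<^sub>M ?P). f' (?S p) * g (fst p))"
    by (subst S, subst integral_distr) (simp_all only: S\<theta>, measurable)
  also have "\<dots> = (LINT t|lborel. LINT c|?P. f' (?S (t, c)) * g t)"
    using LP.integral_fst[OF int] by (simp add: case_prod_unfold)
  \<comment> \<open>This holds for every \<open>t\<close>: where the slice is not integrable, both
    sides have the default value 0.\<close>
  also have "\<dots> = (LINT t|lborel. (LINT c|?P. f' (?S (t, c))) * g t)"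
    by (simp only: integral_mult_left_zero)
  also have "\<dots> = (LINT t|lebesgue. radon_transform \<theta> f t * g t)"
    by (rule integral_completion_cong_AE[symmetric, OF _ aeR]) measurable
  finally show ?thesis .
qed

text \<open>On the ray \<open>\<xi> = r *\<^sub>R \<theta>\<close> the phase and the decay merge
  into a single exponential, linear in \<open>r\<close> with complex rate, so the radial integral in
  polar coordinates is \<open>sphere_kernel\<close>.\<close>

lemma poisson_kernel_sphere_integral:
  fixes v :: "'a::euclidean_space"
  assumes y: "y > 0"
  shows "(LINT \<theta>|sphere_measure. sphere_kernel DIM('a) (complex_of_real (- (v \<bullet> \<theta>)) - \<i> * y)) =
    complex_of_real (poisson_kernel y v)"
proof -
  let ?h = "\<lambda>\<xi>::'a. exp (2 * \<i> * pi * complex_of_real (v \<bullet> \<xi>)) * exp (- complex_of_real (2 * pi * norm \<xi> * y))"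
  have "complex_of_real (poisson_kernel y v) = (LINT \<xi>|lborel. ?h \<xi>)"
    by (rule inverse_fourier_exp_norm(2)[OF y, symmetric])
  also have "\<dots> = (LINT \<theta>|sphere_measure. (LINT r:{0<..}|lborel. r ^ (DIM('a) - 1) *\<^sub>R ?h (r *\<^sub>R \<theta>)))"
    by (rule integral_polar[OF inverse_fourier_exp_norm(1)[OF y]])
  also have "\<dots> = (LINT \<theta>|sphere_measure. sphere_kernel DIM('a) (complex_of_real (- (v \<bullet> \<theta>)) - \<i> * y))"
  proof (rule Bochner_Integration.integral_cong[OF refl])
    fix \<theta> :: 'a assume "\<theta> \<in> space sphere_measure"
    then have \<theta>: "norm \<theta> = 1" by (simp add: space_sphere_measure)
    have "(LINT r:{0<..}|lborel. r ^ (DIM('a) - 1) *\<^sub>R ?h (r *\<^sub>R \<theta>)) =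
      (LINT r:{0<..}|lborel. exp (- (2 * \<i> * pi * (complex_of_real (- (v \<bullet> \<theta>)) - \<i> * y) * complex_of_real r)) * complex_of_real r ^ (DIM('a) - 1))"
    proof (rule set_lebesgue_integral_cong)
      show "\<forall>r. r \<in> {0<..} \<longrightarrow> r ^ (DIM('a) - 1) *\<^sub>R ?h (r *\<^sub>R \<theta>) =
        exp (- (2 * \<i> * pi * (complex_of_real (- (v \<bullet> \<theta>)) - \<i> * y) * complex_of_real r)) * complex_of_real r ^ (DIM('a) - 1)"
      proof (intro allI impI)
        fix r :: real assume "r \<in> {0<..}"
        then have "- (2 * \<i> * pi * (complex_of_real (- (v \<bullet> \<theta>)) - \<i> * y) * complex_of_real r) =
          2 * \<i> * pi * complex_of_real (v \<bullet> (r *\<^sub>R \<theta>)) + - complex_of_real (2 * pi * norm (r *\<^sub>R \<theta>) * y)"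
          using \<theta> by (simp add: algebra_simps)
        then show "r ^ (DIM('a) - 1) *\<^sub>R ?h (r *\<^sub>R \<theta>) =
          exp (- (2 * \<i> * pi * (complex_of_real (- (v \<bullet> \<theta>)) - \<i> * y) * complex_of_real r)) * complex_of_real r ^ (DIM('a) - 1)"
          by (simp only: exp_add) (simp add: scaleR_conv_of_real)
      qed
    qed simp
    also have "\<dots> = sphere_kernel DIM('a) (complex_of_real (- (v \<bullet> \<theta>)) - \<i> * y)"
      using y by (intro sphere_kernel_integral) auto
    finally show "(LINT r:{0<..}|lborel. r ^ (DIM('a) - 1) *\<^sub>R ?h (r *\<^sub>R \<theta>)) =
      sphere_kernel DIM('a) (complex_of_real (- (v \<bullet> \<theta>)) - \<i> * y)" .
  qed
  finally show ?thesis ..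
qed

text \<open>The reflection \<open>t \<mapsto> x - t\<close> preserves Lebesgue measure, hence null
  sets, so \<open>f\<close> may be replaced by \<open>f'\<close> inside the convolution before
  substituting.\<close>

lemma poisson_extension_borel:
  fixes f :: "'a::euclidean_space \<Rightarrow> complex"
  assumes [measurable]: "f' \<in> borel_measurable borel" and ae: "AE x in lborel. f x = f' x"
  shows "poisson_extension f x y = (LINT w|lborel. f' w * poisson_kernel y (x - w))"
proof -
  have [measurable]: "poisson_kernel y \<in> borel_measurable (borel :: 'a measure)"
    unfolding poisson_kernel_def[abs_def] by measurable
  obtain N where N: "\<And>x. x \<in> space lborel - N \<Longrightarrow> f x = f' x" "N \<in> null_sets lborel"
    using AE_E3[OF ae] by blast
  have [measurable]: "N \<in> sets borel" using N(2) by auto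
  have "AE t in lborel. t \<notin> N" by (rule AE_not_in[OF N(2)])
  then have "AE t in lborel. x - t \<notin> N"
    by (subst (asm) lborel_distr_reflect[symmetric, of x], subst (asm) AE_distr_iff) auto
  then have aex: "AE t in lborel. f (x - t) = f' (x - t)"
    by eventually_elim (use N(1) in auto)
  have "poisson_extension f x y = (LINT t|lborel. f' (x - t) * poisson_kernel y t)"
    unfolding poisson_extension_def
    by (rule integral_completion_cong_AE) (use aex in \<open>auto elim: eventually_mono\<close>)
  also have "\<dots> = (LINT t|distr lborel borel (\<lambda>w. x - w). f' (x - t) * poisson_kernel y t)"
    by (simp only: lborel_distr_reflect)
  also have "\<dots> = (LINT w|lborel. f' w * poisson_kernel y (x - w))"
    by (subst integral_distr) auto
  finally show ?thesis .
qed

lemma poisson_extension_eq_sphere_integral: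
  fixes f :: "'a::euclidean_space \<Rightarrow> complex"
  assumes f': "integrable lborel f'" and ae: "AE x in lborel. f x = f' x" and y: "y > 0"
  shows "poisson_extension f x y =
    (LINT \<theta>|sphere_measure. directional_F f \<theta> (complex_of_real (x \<bullet> \<theta>) + \<i> * complex_of_real y))"
proof -
  let ?\<sigma> = "sphere_measure :: 'a measure"
  interpret \<sigma>: finite_measure ?\<sigma> by (rule finite_measure_sphere_measure)
  interpret L\<sigma>: pair_sigma_finite "lborel :: 'a measure" ?\<sigma> ..
  define k where "k w \<theta> = sphere_kernel DIM('a) (complex_of_real (- ((x - w) \<bullet> \<theta>)) - \<i> * complex_of_real y)" for w \<theta>
  have [measurable]: "f' \<in> borel_measurable borel" using f' by auto
  have [measurable]: "snd \<in> borel_measurable (lborel \<Otimes>\<^sub>M ?\<sigma>)"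
    by (rule measurable_compose[OF measurable_snd measurable_sphere_measure_ident])
  have int: "integrable (lborel \<Otimes>\<^sub>M ?\<sigma>) (\<lambda>(w, \<theta>). f' w * k w \<theta>)"
  proof (rule integrable_pair_mult[OF L\<sigma>.pair_sigma_finite_axioms f'])
    \<comment> \<open>The bound on the kernel is uniform in \<open>w\<close> and
      \<open>\<theta>\<close>, and constants are integrable because the sphere has finite
      measure.\<close>
    show "integrable ?\<sigma> (\<lambda>_. fact (DIM('a) - 1) / (2 * pi * y) ^ DIM('a))" by simp
    show "(\<lambda>(w, \<theta>). f' w * k w \<theta>) \<in> borel_measurable (lborel \<Otimes>\<^sub>M ?\<sigma>)"
      unfolding k_def sphere_kernel_def case_prod_unfold by measurable
    show "norm (case (w, \<theta>) of (w, \<theta>) \<Rightarrow> f' w * k w \<theta>) \<le> norm (f' w) * (fact (DIM('a) - 1) / (2 * pi * y) ^ DIM('a))" for w \<theta>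
      unfolding prod.case norm_mult k_def
      using norm_sphere_kernel_le[of "\<i> * complex_of_real y" "DIM('a)" "- ((x - w) \<bullet> \<theta>)"] y by (intro mult_left_mono) auto
  qed
  have "(LINT \<theta>|?\<sigma>. directional_F f \<theta> (complex_of_real (x \<bullet> \<theta>) + \<i> * complex_of_real y)) =
      (LINT \<theta>|?\<sigma>. LINT w|lborel. f' w * k w \<theta>)"
  proof -
    \<comment> \<open>At \<open>z = x \<bullet> \<theta> + \<i> * y\<close> the kernel depends on
      \<open>w\<close> only through \<open>x - w\<close>, which is why averaging over
      \<open>\<theta>\<close> produces a convolution.\<close>
    have *: "complex_of_real (w \<bullet> \<theta>) - (complex_of_real (x \<bullet> \<theta>) + \<i> * complex_of_real y) =
      complex_of_real (- ((x - w) \<bullet> \<theta>)) - \<i> * complex_of_real y" for w \<theta>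
      by (simp add: inner_diff_left)
    have "directional_F f \<theta> (complex_of_real (x \<bullet> \<theta>) + \<i> * complex_of_real y) = (LINT w|lborel. f' w * k w \<theta>)" for \<theta>
      unfolding k_def *[symmetric] by (rule directional_F_eq[OF f' ae]) (use y in simp)
    then show ?thesis by (simp only:)
  qed
  also have "\<dots> = (LINT w|lborel. LINT \<theta>|?\<sigma>. f' w * k w \<theta>)"
    by (rule L\<sigma>.Fubini_integral[OF int])
  also have "\<dots> = (LINT w|lborel. f' w * complex_of_real (poisson_kernel y (x - w)))"
    unfolding k_def integral_mult_right_zero poisson_kernel_sphere_integral[OF y] ..
  also have "\<dots> = poisson_extension f x y"
    by (rule poisson_extension_borel[OF _ ae, symmetric]) measurable
  finally show ?thesis ..
qed

lemma directional_F_eq_radon_integral: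
  fixes f :: "'a::euclidean_space \<Rightarrow> complex"
  assumes \<theta>: "norm \<theta> = 1" and f': "integrable lborel f'" and ae: "AE x in lborel. f x = f' x" and z: "Im z > 0"
  shows "directional_F f \<theta> z = fact (DIM('a) - 1) / (2 * \<i> * pi) ^ DIM('a) *
    (LINT t|lebesgue. radon_transform \<theta> f t / (complex_of_real t - z) ^ DIM('a))"
proof -
  let ?c = "fact (DIM('a) - 1) / (2 * \<i> * pi) ^ DIM('a) :: complex"
  have "directional_F f \<theta> z = (LINT x|lborel. f' x * sphere_kernel DIM('a) (complex_of_real (x \<bullet> \<theta>) - z))"
    by (rule directional_F_eq[OF f' ae z])
  also have "\<dots> = (LINT t|lebesgue. radon_transform \<theta> f t * sphere_kernel DIM('a) (complex_of_real t - z))"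
    by (rule radon_transform_slice[OF \<theta> f' ae _ norm_sphere_kernel_le[OF z]])
      (unfold sphere_kernel_def, measurable)
  also have "\<dots> = (LINT t|lebesgue. ?c * (radon_transform \<theta> f t / (complex_of_real t - z) ^ DIM('a)))"
    unfolding sphere_kernel_altdef by (simp add: mult_ac)
  also have "\<dots> = ?c * (LINT t|lebesgue. radon_transform \<theta> f t / (complex_of_real t - z) ^ DIM('a))"
    by (rule integral_mult_right_zero)
  finally show ?thesis .
qed

theorem mainTheorem1:
  fixes f :: "real ^ 'n \<Rightarrow> complex"
  assumes "CARD('n) \<ge> 2"
    and "integrable lebesgue f"
  shows "(\<forall>x. \<forall>y>0.
            poisson_extension f x y =
            (LINT \<theta>|sphere_measure. directional_F f \<theta> (of_real (x \<bullet> \<theta>) + \<i> * of_real y))) \<and>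
         (\<forall>\<theta>\<in>sphere 0 1. \<forall>z. Im z > 0 \<longrightarrow>
            directional_F f \<theta> z =
            fact (CARD('n) - 1) / (2 * \<i> * pi) ^ CARD('n) *
            (LINT t|lebesgue. radon_transform \<theta> f t / (of_real t - z) ^ CARD('n)))"
proof -
  obtain f' where f': "integrable lborel f'" "AE x in lborel. f x = f' x"
    using integrable_completion_imp_borel[OF assms(2)] .
  show ?thesis
    using poisson_extension_eq_sphere_integral[OF f'] directional_F_eq_radon_integral[OF _ f'] by simp
qed

end
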